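(* Let $K$ be a pre-compact homogeneous metric space, and let $P\neq 0$ and $P'$ be isometrically compatible measures on $K$. Then there is an $l\in\mathbf{R}$ such that $P'=lP$. Consequently, if $P$ and $P'$ are probabilities, they are equal.
   Context: On a metric space $K$ define the homogeneity equivalence: $x\leftrightarrow y$ if and only if there are $\varepsilon>0$ and an isometry from the open ball $B(x;\varepsilon)$ onto the open ball $B(y;\varepsilon)$. $K$ is homogeneous if $\leftrightarrow$ has only one equivalence class. An isometrically compatible measure on $K$ is a measure $m$ defined on the Borel sets of $K$ such that $m(U)=m(V)$ for every pair $(U,V)$ of open sets of $K$ for which there is an isometry from $U$ onto $V$ (distances induced by that of $K$).
   Formalization: In the homogeneity equivalence the isometry from B(x;ε) onto B(y;ε) must also send x to y (otherwise every bounded space is homogeneous and the claim fails), and the measures P and P' are assumed finite (arc length and counting measure on a circle are not proportional). *)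

theory Defs
  imports "HOL-Probability.Probability"
begin

definition isometry_onto :: "('a::metric_space \<Rightarrow> 'a) \<Rightarrow> 'a set \<Rightarrow> 'a set \<Rightarrow> bool" where
  "isometry_onto f U V \<longleftrightarrow> f ` U = V \<and> (\<forall>x\<in>U. \<forall>y\<in>U. dist (f x) (f y) = dist x y)"

text \<open>
  The isometry between the two balls is required to carry centre to centre. Without this,
  any two points of a bounded space would be related, by the identity on a ball of large radius.
\<close>

definition homogeneity_rel :: "('a::metric_space \<times> 'a) set" where
  "homogeneity_rel =
     {(x, y). \<exists>\<epsilon>>0. \<exists>f. isometry_onto f (ball x \<epsilon>) (ball y \<epsilon>) \<and> f x = y}"

definition homogeneous_space :: "'a::metric_space itself \<Rightarrow> bool" where
  "homogeneous_space _ \<longleftrightarrow>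
     is_singleton ((UNIV :: 'a set) // (homogeneity_rel :: ('a \<times> 'a) set))"

definition isometrically_compatible :: "'a::metric_space measure \<Rightarrow> bool" where
  "isometrically_compatible m \<longleftrightarrow> sets m = sets borel \<and>
     (\<forall>U V. open U \<longrightarrow> open V \<longrightarrow> (\<exists>f. isometry_onto f U V) \<longrightarrow> emeasure m U = emeasure m V)"

lemma isometry_onto_id: "isometry_onto (\<lambda>x. x) U U"
  by (simp add: isometry_onto_def)

lemma isometry_onto_inv:
  assumes "isometry_onto f U V"
  shows "isometry_onto (inv_into U f) V U" and "inj_on f U"
proof -
  have d: "\<And>x y. x \<in> U \<Longrightarrow> y \<in> U \<Longrightarrow> dist (f x) (f y) = dist x y" and V: "V = f ` U"
    using assms by (auto simp: isometry_onto_def)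
  show inj: "inj_on f U"
  proof (rule inj_onI)
    fix x y assume "x \<in> U" "y \<in> U" "f x = f y"
    with d[of x y] show "x = y" by simp
  qed
  show "isometry_onto (inv_into U f) V U"
    unfolding isometry_onto_def V using inj by (simp add: inv_into_image_cancel d)
qed

lemma isometry_onto_subball:
  assumes f: "isometry_onto f (ball x \<epsilon>) (ball y \<epsilon>)" and "f x = y" and "0 < \<delta>" "\<delta> \<le> \<epsilon>"
  shows "isometry_onto f (ball x \<delta>) (ball y \<delta>)"
proof -
  have sub: "ball x \<delta> \<subseteq> ball x \<epsilon>" and "ball y \<delta> \<subseteq> ball y \<epsilon>"
    using assms by auto
  have d: "\<And>u v. u \<in> ball x \<epsilon> \<Longrightarrow> v \<in> ball x \<epsilon> \<Longrightarrow> dist (f u) (f v) = dist u v"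
    and im: "f ` ball x \<epsilon> = ball y \<epsilon>"
    using f by (auto simp: isometry_onto_def)
  have x: "x \<in> ball x \<epsilon>"
    using assms by auto
  have y: "\<And>u. u \<in> ball x \<epsilon> \<Longrightarrow> dist y (f u) = dist x u"
    using d[OF x] \<open>f x = y\<close> by simp
  have "f ` ball x \<delta> = ball y \<delta>"
  proof
    show "f ` ball x \<delta> \<subseteq> ball y \<delta>"
    proof
      fix w assume "w \<in> f ` ball x \<delta>"
      then obtain u where "u \<in> ball x \<delta>" "w = f u" by blast
      with y[of u] sub show "w \<in> ball y \<delta>" by auto
    qed
    show "ball y \<delta> \<subseteq> f ` ball x \<delta>"
    proof
      fix w assume w: "w \<in> ball y \<delta>"
      then obtain u where u: "u \<in> ball x \<epsilon>" "w = f u"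
        using im \<open>ball y \<delta> \<subseteq> ball y \<epsilon>\<close> by blast
      with y[of u] w have "u \<in> ball x \<delta>" by simp
      with u show "w \<in> f ` ball x \<delta>" by blast
    qed
  qed
  moreover have "dist (f u) (f v) = dist u v" if "u \<in> ball x \<delta>" "v \<in> ball x \<delta>" for u v
    using d that sub by blast
  ultimately show ?thesis
    by (simp add: isometry_onto_def)
qed

lemma equiv_homogeneity_rel: "equiv UNIV (homogeneity_rel :: ('a::metric_space \<times> 'a) set)"
proof (rule equivI)
  show "(homogeneity_rel :: ('a \<times> 'a) set) \<subseteq> UNIV \<times> UNIV" by simp
  have "(x, x) \<in> homogeneity_rel" for x :: 'a
    unfolding homogeneity_rel_def using isometry_onto_id zero_less_one by blast
  then show "refl (homogeneity_rel :: ('a \<times> 'a) set)"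
    by (simp add: refl_on_def)
  show "sym (homogeneity_rel :: ('a \<times> 'a) set)"
  proof (rule symI)
    fix x y :: 'a assume "(x, y) \<in> homogeneity_rel"
    then obtain \<epsilon> f where e: "\<epsilon> > 0" and f: "isometry_onto f (ball x \<epsilon>) (ball y \<epsilon>)" "f x = y"
      by (auto simp: homogeneity_rel_def)
    have "inv_into (ball x \<epsilon>) f y = x"
      using inv_into_f_f[OF isometry_onto_inv(2)[OF f(1)], of x] e f(2) by simp
    with isometry_onto_inv(1)[OF f(1)] e show "(y, x) \<in> homogeneity_rel"
      by (auto simp: homogeneity_rel_def)
  qed
  show "trans (homogeneity_rel :: ('a \<times> 'a) set)"
  proof (rule transI)
    fix x y z :: 'a
    assume "(x, y) \<in> homogeneity_rel" and "(y, z) \<in> homogeneity_rel"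
    then obtain \<epsilon> f \<delta> g where e: "\<epsilon> > 0" "\<delta> > 0"
      and f: "isometry_onto f (ball x \<epsilon>) (ball y \<epsilon>)" "f x = y"
      and g: "isometry_onto g (ball y \<delta>) (ball z \<delta>)" "g y = z"
      by (auto simp: homogeneity_rel_def)
    define r where "r = min \<epsilon> \<delta>"
    have r: "r > 0" "r \<le> \<epsilon>" "r \<le> \<delta>" using e by (auto simp: r_def)
    have f': "isometry_onto f (ball x r) (ball y r)" and g': "isometry_onto g (ball y r) (ball z r)"
      by (rule isometry_onto_subball[OF f r(1,2)], rule isometry_onto_subball[OF g r(1,3)])
    have "f u \<in> ball y r" if "u \<in> ball x r" for u
      using f' that unfolding isometry_onto_def by blast
    moreover have "(g \<circ> f) ` ball x r = ball z r"
      using f' g' unfolding isometry_onto_def image_comp[symmetric] by simp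
    ultimately have "isometry_onto (g \<circ> f) (ball x r) (ball z r)"
      using f' g' by (simp add: isometry_onto_def)
    moreover have "(g \<circ> f) x = z" using f(2) g(2) by simp
    ultimately show "(x, z) \<in> homogeneity_rel"
      unfolding homogeneity_rel_def using r(1) by blast
  qed
qed

lemma homogeneous_space_iff:
  "homogeneous_space TYPE('a::metric_space) \<longleftrightarrow> (\<forall>x y :: 'a. (x, y) \<in> homogeneity_rel)"
proof
  assume "homogeneous_space TYPE('a)"
  then obtain C where C: "(UNIV :: 'a set) // homogeneity_rel = {C}"
    by (auto simp: homogeneous_space_def is_singleton_def)
  have *: "homogeneity_rel `` {x} = C" for x :: 'a
    using quotientI[of x UNIV homogeneity_rel] C by auto
  show "\<forall>x y :: 'a. (x, y) \<in> homogeneity_rel"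
    by (intro allI eq_equiv_class[OF _ equiv_homogeneity_rel UNIV_I]) (simp only: *)
next
  assume "\<forall>x y :: 'a. (x, y) \<in> homogeneity_rel"
  then have "(UNIV :: 'a set) // homogeneity_rel = {UNIV}"
    by (auto simp: quotient_def)
  then show "homogeneous_space TYPE('a)"
    by (simp add: homogeneous_space_def)
qed

end

theory Submission
  imports Defs
begin

text \<open>
  Replacing \<open>P\<close> by \<open>M = P + P'\<close> we may compare \<open>N = P'\<close> with a measure that dominates it. Two points
  have isometric balls of some radius, but this radius is not bounded below, so the usual argument,
  which averages over small balls and lets the radius tend to 0, is not available: points without
  a large isometric ball may carry most of the mass near a given point. Instead the radius \<open>r\<close> stays
  fixed, and inside \<open>ball z r\<close> the density of \<open>N\<close> with respect to \<open>M\<close> is approximated by its conditional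
  expectation on the partition cut out by a random finite \<open>e\<close>-net of \<open>ball z r\<close>. The average of this
  over all nets and all \<open>z\<close> near \<open>x\<close> is an isometry invariant of the ball of radius \<open>2 * r\<close> at \<open>x\<close>.
  On the set where this invariant (for all \<open>e\<close> from a null sequence) and \<open>M (ball x r)\<close>
  agree with their values at a base point, letting \<open>e\<close> tend to 0 shows that \<open>N\<close> is a multiple of \<open>M\<close>;
  these sets exhaust the space as \<open>r\<close> tends to 0.
\<close>

section \<open>Setwise convergence of measures\<close>

lemma Inter_thickening_closed:
  fixes F :: "'a::metric_space set"
  assumes "closed F" and d: "d \<longlonglongrightarrow> 0"
    and pos: "\<And>j::nat. 0 < d j"
  shows "(\<Inter>j. \<Union>x\<in>F. ball x (d j)) = F"
proof
  show "(\<Inter>j. \<Union>x\<in>F. ball x (d j)) \<subseteq> F"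
  proof
    fix y assume y: "y \<in> (\<Inter>j. \<Union>x\<in>F. ball x (d j))"
    have "\<exists>x\<in>F. dist x y < e" if "0 < e" for e
    proof -
      have "\<forall>\<^sub>F j in sequentially. d j < e"
        by (rule order_tendstoD(2)[OF d that])
      then obtain j where "d j < e"
        using eventually_happens'[OF sequentially_bot] by blast
      moreover obtain x where "x \<in> F" "dist x y < d j"
        using y by auto
      ultimately show ?thesis by force
    qed
    then have "y \<in> closure F"
      by (simp add: closure_approachable)
    with \<open>closed F\<close> show "y \<in> F" by simp
  qed
qed (use pos in force)

text \<open>On a closed set \<open>F\<close> the two thickening bounds squeeze the values: the
  thickenings decrease to \<open>F\<close>, and the domination by \<open>C * measure M\<close> makes
  what any \<open>L j\<close> puts into a thickening outside \<open>F\<close> negligible. The same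
  domination carries convergence through countable disjoint unions, so a pi-lambda argument reaches
  all Borel sets and not just those with null boundary, as weak convergence alone would.\<close>

lemma borel_measure_tendsto_of_thickenings:
  fixes L :: "nat \<Rightarrow> 'a::metric_space measure" and R M :: "'a measure"
  assumes L: "\<And>j. finite_measure (L j)" "\<And>j. sets (L j) = sets borel"
    and R: "finite_measure R" "sets R = sets borel"
    and M: "finite_measure M" "sets M = sets borel"
    and bound: "\<And>j A. A \<in> sets borel \<Longrightarrow> measure (L j) A \<le> C * measure M A"
    and upper: "\<And>j F. closed F \<Longrightarrow> measure (L j) F \<le> measure R (\<Union>x\<in>F. ball x (d j))"
    and lower: "\<And>j F. closed F \<Longrightarrow> measure R F \<le> measure (L j) (\<Union>x\<in>F. ball x (d j))"
    and d: "decseq d" "d \<longlonglongrightarrow> 0" "\<And>j. 0 < d j"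
    and A: "A \<in> sets borel"
  shows "(\<lambda>j. measure (L j) A) \<longlonglongrightarrow> measure R A"
proof -
  interpret R: finite_measure R by fact
  interpret M: finite_measure M by fact
  interpret L: finite_measure "L j" for j by fact
  have spaces: "space R = UNIV" "space M = UNIV" "space (L j) = UNIV" for j
    using R(2) M(2) L(2) by (simp_all add: sets_eq_imp_space_eq)
  note [simp] = L(2) R(2) M(2)
  have closed_case: "(\<lambda>j. measure (L j) F) \<longlonglongrightarrow> measure R F" if F: "closed F" for F
  proof -
    define U where "U j = (\<Union>x\<in>F. ball x (d j))" for j
    have oU: "open (U j)" for j by (auto simp: U_def)
    then have bU [simp]: "U j \<in> sets borel" for j by simp
    have bF [simp]: "F \<in> sets borel" using F by simp
    have rU: "range U \<subseteq> sets borel" by auto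
    have dec: "decseq U"
      unfolding decseq_def U_def using d(1) by (force simp: decseq_def)
    have Int: "(\<Inter>j. U j) = F"
      unfolding U_def by (rule Inter_thickening_closed[OF F d(2,3)])
    have FU: "F \<subseteq> U j" for j using Int by auto
    have R_lim: "(\<lambda>j. measure R (U j)) \<longlonglongrightarrow> measure R F"
      using R.finite_Lim_measure_decseq[of U] dec Int rU by simp
    have "(\<lambda>j. measure M (U j)) \<longlonglongrightarrow> measure M F"
      using M.finite_Lim_measure_decseq[of U] dec Int rU by simp
    moreover have "measure M (U j - F) = measure M (U j) - measure M F" for j
      using FU by (simp add: M.finite_measure_Diff)
    ultimately have M_lim: "(\<lambda>j. C * measure M (U j - F)) \<longlonglongrightarrow> C * (measure M F - measure M F)"
      by (simp only:) (intro tendsto_intros)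
    have "measure R F \<le> measure (L j) F + C * measure M (U j - F)" for j
    proof -
      have "measure R F \<le> measure (L j) (U j)"
        unfolding U_def by (rule lower[OF F])
      also have "\<dots> = measure (L j) F + measure (L j) (U j - F)"
        using FU by (simp add: L.finite_measure_Diff)
      finally show ?thesis using bound[of "U j - F" j] sets.Diff[OF bU bF, of j] by simp
    qed
    then have low: "measure R F - C * measure M (U j - F) \<le> measure (L j) F" for j
      by (simp add: algebra_simps)
    show ?thesis
    proof (rule tendsto_sandwich)
      show "(\<lambda>j. measure R F - C * measure M (U j - F)) \<longlonglongrightarrow> measure R F"
        using tendsto_diff[OF tendsto_const M_lim] by simp
      show "\<forall>\<^sub>F j in sequentially. measure (L j) F \<le> measure R (U j)"
        using upper[OF F] by (simp add: U_def)
    qed (use low R_lim in auto)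
  qed
  have "Int_stable (Collect closed :: 'a set set)" "Collect closed \<subseteq> Pow (UNIV :: 'a set)"
    "A \<in> sigma_sets UNIV (Collect closed)"
    using A by (auto simp: Int_stable_def borel_eq_closed)
  then show ?thesis
  proof (induction rule: sigma_sets_induct_disjoint)
    case (basic A)
    then show ?case using closed_case by simp
  next
    case empty
    then show ?case by simp
  next
    case (compl A)
    then have [simp]: "A \<in> sets borel" by (simp add: borel_eq_closed)
    have "measure (L j) (UNIV - A) = measure (L j) UNIV - measure (L j) A" for j
      using L.finite_measure_compl[of A j] by (simp add: spaces)
    moreover have "measure R (UNIV - A) = measure R UNIV - measure R A"
      using R.finite_measure_compl[of A] by (simp add: spaces)
    ultimately show ?case
      using tendsto_diff[OF closed_case[of UNIV] compl(2)] by simp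
  next
    case (union A)
    have rA: "range A \<subseteq> sets borel" and [simp]: "A i \<in> sets borel" for i
      using union(2) by (auto simp: borel_eq_closed)
    \<comment> \<open>These terms are the majorant, independent of \<open>j\<close>, that Tannery's
      theorem needs to exchange limit and sum.\<close>
    have summ: "summable (\<lambda>i. C * measure M (A i))"
      using M.finite_measure_UNION[of A] rA union(1) by (auto intro!: summable_mult simp: sums_iff)
    have "((\<lambda>j. \<Sum>i. measure (L j) (A i)) \<longlongrightarrow> (\<Sum>i. measure R (A i))) sequentially"
      using union summ bound
      by (intro tannerys_theorem[where M = "\<lambda>i. C * measure M (A i)", THEN conjunct2, THEN conjunct2] always_eventually) auto
    moreover have "measure (L j) (\<Union>i. A i) = (\<Sum>i. measure (L j) (A i))" for j
      using L.finite_measure_UNION[of A j] rA union(1) by (auto simp: sums_iff)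
    moreover have "measure R (\<Union>i. A i) = (\<Sum>i. measure R (A i))"
      using R.finite_measure_UNION[of A] rA union(1) by (auto simp: sums_iff)
    ultimately show ?case by simp
  qed
qed

section \<open>Averaged density ratios over random nets\<close>

text \<open>Each point goes to the first centre that sees it. The rule uses only distances and the
  order of the tuple, so an isometry that moves the tuple along carries cells to cells.\<close>

definition cell :: "real \<Rightarrow> real \<Rightarrow> 'a::metric_space \<Rightarrow> (nat \<Rightarrow> 'a) \<Rightarrow> nat \<Rightarrow> 'a set" where
  "cell r e z w i = ball z r \<inter> ball (w i) e - (\<Union>j<i. ball (w j) e)"

text \<open>Covering is asked only up to an \<open>M\<close>-null set: this turns it into a
  condition on the measure of a section, which is measurable jointly in \<open>z\<close> and
  \<open>w\<close>.\<close>

definition frame_net :: "'a::metric_space measure \<Rightarrow> real \<Rightarrow> real \<Rightarrow> nat \<Rightarrow> 'a \<Rightarrow> (nat \<Rightarrow> 'a) \<Rightarrow> bool" where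
  "frame_net M r e n z w \<longleftrightarrow>
     (\<forall>i<n. w i \<in> ball z r) \<and> emeasure M (ball z r - (\<Union>i<n. ball (w i) e)) = 0"

text \<open>
  The conditional expectation of the density of \<open>N\<close> with respect to \<open>M\<close> on the partition into
  cells; on null cells it has the value \<open>0 / 0 = 0\<close>.
\<close>

definition cell_ratio ::
  "'a::metric_space measure \<Rightarrow> 'a measure \<Rightarrow> real \<Rightarrow> real \<Rightarrow> nat \<Rightarrow> 'a \<Rightarrow> (nat \<Rightarrow> 'a) \<Rightarrow> 'a \<Rightarrow> ennreal" where
  "cell_ratio M N r e n z w x =
     (\<Sum>i<n. indicator (cell r e z w i) x *
        (emeasure N (cell r e z w i) / emeasure M (cell r e z w i)))"

abbreviation frames :: "'a measure \<Rightarrow> nat \<Rightarrow> (nat \<Rightarrow> 'a) measure" where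
  "frames M n \<equiv> PiM {..<n} (\<lambda>_. M)"

text \<open>An integral rather than \<open>emeasure\<close>:
  \<open>Collect (frame_net M r e n z)\<close> may contain functions that are not extensional, and
  is then no measurable set of \<open>frames M n\<close>. The integral sees only the extensional
  ones.\<close>

definition net_mass :: "'a::metric_space measure \<Rightarrow> real \<Rightarrow> real \<Rightarrow> nat \<Rightarrow> 'a \<Rightarrow> ennreal" where
  "net_mass M r e n z = (\<integral>\<^sup>+w. indicator (Collect (frame_net M r e n z)) w \<partial>frames M n)"

text \<open>
  Dividing by \<open>net_mass\<close> keeps the total weight of the points \<open>z\<close> seen from \<open>x\<close> independent of \<open>e\<close>.
\<close>

definition mean_ratio ::
  "'a::metric_space measure \<Rightarrow> 'a measure \<Rightarrow> real \<Rightarrow> real \<Rightarrow> nat \<Rightarrow> 'a \<Rightarrow> 'a \<Rightarrow> ennreal" where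
  "mean_ratio M N r e n z x =
     (\<integral>\<^sup>+w. indicator (Collect (frame_net M r e n z)) w * cell_ratio M N r e n z w x \<partial>frames M n)
       / net_mass M r e n z"

definition profile ::
  "'a::metric_space measure \<Rightarrow> 'a measure \<Rightarrow> real \<Rightarrow> real \<Rightarrow> nat \<Rightarrow> 'a \<Rightarrow> ennreal" where
  "profile M N r e n x = (\<integral>\<^sup>+z. mean_ratio M N r e n z x \<partial>M)"

text \<open>The domination \<open>N_le_M\<close> keeps all cell ratios at most 1 and makes the part
  of a ball missed by a net null for \<open>N\<close> too.\<close>

locale separable_measure_pair =
  M: finite_measure M + N: finite_measure N for M N :: "'a::metric_space measure" +
  fixes D :: "'a set"
  assumes D: "countable D" "\<And>x e. 0 < e \<Longrightarrow> \<exists>d\<in>D. dist x d < e"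
    and sets_M [simp, measurable_cong]: "sets M = sets borel"
    and sets_N [simp, measurable_cong]: "sets N = sets borel"
    and N_le_M: "\<And>A. A \<in> sets borel \<Longrightarrow> emeasure N A \<le> emeasure M A"
begin

section \<open>Measurability in the centre, the net and the point\<close>

lemma space_M [simp]: "space M = UNIV" and space_N [simp]: "space N = UNIV"
  using sets_eq_imp_space_eq[OF sets_M] sets_eq_imp_space_eq[OF sets_N] by simp_all

text \<open>
  The type carries no second-countability class, so the library facts about \<open>dist\<close>
  on products do not apply; the countable dense set replaces them.
\<close>

lemma borel_measurable_dist_separable [measurable (raw)]:
  assumes f: "f \<in> L \<rightarrow>\<^sub>M (borel :: 'a measure)" and g: "g \<in> L \<rightarrow>\<^sub>M (borel :: 'a measure)"
  shows "(\<lambda>l. dist (f l) (g l)) \<in> borel_measurable L"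
proof -
  \<comment> \<open>A countable disjunction of conditions on distances to a fixed point, each of
    which is continuous.\<close>
  have eq: "dist (f l) (g l) < r \<longleftrightarrow> (\<exists>d\<in>D. \<exists>q\<in>\<rat>. dist (f l) d < q \<and> dist (g l) d < r - q)" for l r
  proof
    assume "dist (f l) (g l) < r"
    then obtain d where d: "d \<in> D" "dist (f l) d < (r - dist (f l) (g l)) / 2"
      using D(2)[of "(r - dist (f l) (g l)) / 2" "f l"] by auto
    have "dist (g l) d \<le> dist (f l) (g l) + dist (f l) d"
      using dist_triangle[of "g l" d "f l"] by (simp add: dist_commute)
    with d(2) have "dist (f l) d < r - dist (g l) d" by (simp add: field_simps)
    from Rats_dense_in_real[OF this] obtain q where "q \<in> \<rat>" "dist (f l) d < q" "q < r - dist (g l) d"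
      by blast
    with d(1) show "\<exists>d\<in>D. \<exists>q\<in>\<rat>. dist (f l) d < q \<and> dist (g l) d < r - q"
      by (intro bexI[of _ d] bexI[of _ q]) auto
  next
    assume "\<exists>d\<in>D. \<exists>q\<in>\<rat>. dist (f l) d < q \<and> dist (g l) d < r - q"
    then obtain d q where "dist (f l) d < q" "dist (g l) d < r - q" by blast
    with dist_triangle2[of "f l" "g l" d] show "dist (f l) (g l) < r" by simp
  qed
  have [measurable]: "(\<lambda>y. dist y d) \<in> borel_measurable borel" for d :: 'a
    by (intro borel_measurable_continuous_onI continuous_intros)
  note [measurable] = f g
  have "countable (\<rat> :: real set)" by (rule countable_rat)
  with D(1) have "Measurable.pred L (\<lambda>l. dist (f l) (g l) < r)" for r
    unfolding eq by measurable
  then show ?thesis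
    by (simp add: borel_measurable_iff_less pred_def)
qed

lemma pred_in_cell:
  assumes [measurable]: "fz \<in> L \<rightarrow>\<^sub>M (borel :: 'a measure)" "fx \<in> L \<rightarrow>\<^sub>M borel"
    and fw: "\<And>i. i < n \<Longrightarrow> (\<lambda>l. fw l i) \<in> L \<rightarrow>\<^sub>M borel" and "i < n"
  shows "Measurable.pred L (\<lambda>l. fx l \<in> cell r e (fz l) (fw l) i)"
proof -
  have [measurable]: "(\<lambda>l. fw l j) \<in> L \<rightarrow>\<^sub>M borel" if "j \<in> {..<i}" for j
    using fw[of j] \<open>i < n\<close> that by simp
  have [measurable]: "(\<lambda>l. fw l i) \<in> L \<rightarrow>\<^sub>M borel"
    using fw \<open>i < n\<close> by simp
  have eq: "fx l \<in> cell r e (fz l) (fw l) i \<longleftrightarrow>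
      dist (fz l) (fx l) < r \<and> dist (fw l i) (fx l) < e \<and> (\<forall>j\<in>{..<i}. \<not> dist (fw l j) (fx l) < e)" for l
    by (auto simp: cell_def)
  show ?thesis unfolding eq by measurable
qed

text \<open>Only the sigma-algebra of the second factor enters the hypothesis, so one proof about
  \<open>M\<close> serves for measuring sections with \<open>M\<close> and with
  \<open>N\<close>.\<close>

lemma measurable_emeasure_section:
  assumes "Measurable.pred (L \<Otimes>\<^sub>M M) (\<lambda>(l, u). u \<in> S l)" "finite_measure K" "sets K = sets borel"
  shows "(\<lambda>l. emeasure K (S l)) \<in> borel_measurable L"
proof -
  interpret K: finite_measure K by fact
  have "{p \<in> space (L \<Otimes>\<^sub>M K). snd p \<in> S (fst p)} \<in> sets (L \<Otimes>\<^sub>M K)"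
    using assms(1) sets_pair_measure_cong[OF refl, of M K L] assms(3)
    by (simp add: pred_def case_prod_beta' sets_eq_imp_space_eq[of "L \<Otimes>\<^sub>M M" "L \<Otimes>\<^sub>M K"])
  from K.measurable_emeasure_Pair[OF this]
  show ?thesis
    by (rule measurable_cong[THEN iffD1, rotated])
      (auto simp: space_pair_measure sets_eq_imp_space_eq[OF assms(3)] intro!: arg_cong[where f = "emeasure K"])
qed

lemma measurable_frame_net:
  assumes [measurable]: "fz \<in> L \<rightarrow>\<^sub>M borel"
    and fw: "\<And>i. i < n \<Longrightarrow> (\<lambda>l. fw l i) \<in> L \<rightarrow>\<^sub>M borel"
  shows "Measurable.pred L (\<lambda>l. frame_net M r e n (fz l) (fw l))"
proof -
  have [measurable]: "(\<lambda>l. fw l i) \<in> L \<rightarrow>\<^sub>M borel" if "i \<in> {..<n}" for i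
    using fw that by simp
  have eq: "u \<in> ball (fz l) r - (\<Union>i<n. ball (fw l i) e) \<longleftrightarrow>
      dist (fz l) u < r \<and> (\<forall>i\<in>{..<n}. \<not> dist (fw l i) u < e)" for l u
    by auto
  have "Measurable.pred (L \<Otimes>\<^sub>M M) (\<lambda>(l, u). u \<in> ball (fz l) r - (\<Union>i<n. ball (fw l i) e))"
    unfolding eq by measurable
  from measurable_emeasure_section[OF this M.finite_measure_axioms sets_M]
  have [measurable]: "(\<lambda>l. emeasure M (ball (fz l) r - (\<Union>i<n. ball (fw l i) e))) \<in> borel_measurable L" .
  have "(\<forall>i<n. fw l i \<in> ball (fz l) r) \<longleftrightarrow> (\<forall>i\<in>{..<n}. dist (fz l) (fw l i) < r)" for l
    by auto
  then show ?thesis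
    unfolding frame_net_def by (simp only:) measurable
qed

lemma borel_measurable_cell_ratio:
  assumes [measurable]: "fz \<in> L \<rightarrow>\<^sub>M borel" "fx \<in> L \<rightarrow>\<^sub>M borel"
    and fw: "\<And>i. i < n \<Longrightarrow> (\<lambda>l. fw l i) \<in> L \<rightarrow>\<^sub>M borel"
  shows "(\<lambda>l. cell_ratio M N r e n (fz l) (fw l) (fx l)) \<in> borel_measurable L"
proof -
  have cellM: "(\<lambda>l. emeasure K (cell r e (fz l) (fw l) i)) \<in> borel_measurable L"
    if "i < n" and K: "finite_measure K" "sets K = sets borel" for i K
  proof (rule measurable_emeasure_section[OF _ K])
    have "Measurable.pred (L \<Otimes>\<^sub>M M) (\<lambda>p. snd p \<in> cell r e (fz (fst p)) (fw (fst p)) i)"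
    proof (rule pred_in_cell[OF _ _ _ \<open>i < n\<close>])
      show "(\<lambda>p. fw (fst p) j) \<in> L \<Otimes>\<^sub>M M \<rightarrow>\<^sub>M borel" if "j < n" for j
        using measurable_compose[OF measurable_fst fw[OF that]] .
    qed measurable
    then show "Measurable.pred (L \<Otimes>\<^sub>M M) (\<lambda>(l, u). u \<in> cell r e (fz l) (fw l) i)"
      unfolding case_prod_beta' .
  qed
  have ind: "(\<lambda>l. indicator (cell r e (fz l) (fw l) i) (fx l) :: ennreal) \<in> borel_measurable L"
    if "i < n" for i
  proof -
    have [measurable]: "Measurable.pred L (\<lambda>l. fx l \<in> cell r e (fz l) (fw l) i)"
      by (rule pred_in_cell[OF assms that])
    show ?thesis unfolding indicator_def of_bool_def by measurable
  qed
  show ?thesis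
    unfolding cell_ratio_def
  proof (intro borel_measurable_sum borel_measurable_times_ennreal borel_measurable_divide_ennreal)
    fix i assume "i \<in> {..<n}"
    then show
      "(\<lambda>l. indicator (cell r e (fz l) (fw l) i) (fx l) :: ennreal) \<in> borel_measurable L"
      "(\<lambda>l. emeasure N (cell r e (fz l) (fw l) i)) \<in> borel_measurable L"
      "(\<lambda>l. emeasure M (cell r e (fz l) (fw l) i)) \<in> borel_measurable L"
      by (simp_all only: lessThan_iff ind cellM M.finite_measure_axioms N.finite_measure_axioms sets_M sets_N)
  qed
qed

end

section \<open>Cell averages over a fixed net\<close>

lemma ennreal_divide_le_one:
  fixes a b :: ennreal
  assumes "a \<le> b" "b < top"
  shows "a / b \<le> 1"
  using assms by (cases "b = 0") (auto simp: divide_le_posI_ennreal zero_less_iff_neq_zero)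

lemma cell_subset_ball: "cell r e z w i \<subseteq> ball z r"
  by (auto simp: cell_def)

lemma disjoint_cells: "disjoint_family_on (cell r e z w) I"
proof -
  have "cell r e z w i \<inter> cell r e z w j = {}" if "i < j" for i j
    using that by (auto simp: cell_def)
  then show ?thesis
    unfolding disjoint_family_on_def by (metis Int_commute linorder_neqE_nat)
qed

lemma UN_cell: "(\<Union>i<n. cell r e z w i) = ball z r \<inter> (\<Union>i<n. ball (w i) e)"
proof
  show "ball z r \<inter> (\<Union>i<n. ball (w i) e) \<subseteq> (\<Union>i<n. cell r e z w i)"
  proof
    fix x assume x: "x \<in> ball z r \<inter> (\<Union>i<n. ball (w i) e)"
    define k where "k = (LEAST i. x \<in> ball (w i) e)"
    from x obtain i where i: "i < n" "x \<in> ball (w i) e" by blast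
    then have "x \<in> ball (w k) e" "k \<le> i"
      unfolding k_def by (auto intro: LeastI Least_le)
    moreover have "x \<notin> ball (w j) e" if "j < k" for j
      using not_less_Least that unfolding k_def by blast
    ultimately show "x \<in> (\<Union>i<n. cell r e z w i)"
      using x i(1) by (auto simp: cell_def intro!: bexI[of _ k])
  qed
qed (auto simp: cell_def)

lemma sets_cell [measurable]: "cell r e z w i \<in> sets borel"
  by (simp add: cell_def)

text \<open>Any two points of a cell lie within \<open>e\<close> of a common centre; this is where
  the radius \<open>2 * e\<close> of the later comparisons comes from.\<close>

lemma cell_subset_thickening:
  assumes "x \<in> F" "x \<in> cell r e z w i"
  shows "cell r e z w i \<subseteq> (\<Union>x\<in>F. ball x (2 * e))"
proof
  fix y assume "y \<in> cell r e z w i"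
  with assms(2) have "dist (w i) y < e" "dist (w i) x < e" by (auto simp: cell_def)
  with dist_triangle3[of x y "w i"] have "dist x y < 2 * e" by simp
  with assms(1) show "y \<in> (\<Union>x\<in>F. ball x (2 * e))" by auto
qed

context separable_measure_pair
begin

lemma emeasure_M_finite: "emeasure M A < top"
  by (simp add: less_top[symmetric])

text \<open>At most one cell contains \<open>x\<close>, and its ratio is at most 1 by
  domination.\<close>

lemma cell_ratio_le: "cell_ratio M N r e n z w x \<le> indicator (ball z r) x"
proof -
  define c where "c i = cell r e z w i" for i
  have le: "indicator (c i) x * (emeasure N (c i) / emeasure M (c i)) \<le> (indicator (c i) x :: ennreal)" for i
    using mult_left_mono[OF ennreal_divide_le_one[OF N_le_M emeasure_M_finite], of "c i" "indicator (c i) x"]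
    by (simp add: c_def)
  have "cell_ratio M N r e n z w x \<le> (\<Sum>i<n. indicator (c i) x)"
    unfolding cell_ratio_def c_def[symmetric] by (intro sum_mono le)
  also have "\<dots> = indicator (\<Union>i<n. c i) x"
    using disjoint_cells unfolding c_def by (intro indicator_UN_disjoint[symmetric]) auto
  also have "\<dots> \<le> indicator (ball z r) x"
    using cell_subset_ball unfolding c_def by (intro indicator_leI) blast
  finally show ?thesis .
qed

lemma nn_integral_cell_ratio:
  assumes [measurable]: "F \<in> sets borel"
  shows "(\<integral>\<^sup>+x. indicator F x * cell_ratio M N r e n z w x \<partial>M) =
    (\<Sum>i<n. emeasure M (F \<inter> cell r e z w i) * (emeasure N (cell r e z w i) / emeasure M (cell r e z w i)))"
proof -
  have "(\<integral>\<^sup>+x. indicator F x * cell_ratio M N r e n z w x \<partial>M) =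
      (\<integral>\<^sup>+x. (\<Sum>i<n. (emeasure N (cell r e z w i) / emeasure M (cell r e z w i)) *
         indicator (F \<inter> cell r e z w i) x) \<partial>M)"
    by (intro nn_integral_cong) (simp add: cell_ratio_def sum_distrib_left indicator_inter_arith ac_simps)
  also have "\<dots> = (\<Sum>i<n. (emeasure N (cell r e z w i) / emeasure M (cell r e z w i)) *
      emeasure M (F \<inter> cell r e z w i))"
    by (subst nn_integral_sum) (auto simp: nn_integral_cmult_indicator)
  finally show ?thesis by (simp add: mult.commute)
qed

lemma sum_emeasure_N_cells:
  assumes [measurable]: "F \<in> sets borel"
  shows "(\<Sum>i<n. emeasure N (F \<inter> cell r e z w i)) = emeasure N (F \<inter> (\<Union>i<n. cell r e z w i))"
proof -
  have "disjoint_family_on (\<lambda>i. F \<inter> cell r e z w i) {..<n}"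
    using disjoint_cells[of r e z w "{..<n}"] by (auto simp: disjoint_family_on_def)
  then have "(\<Sum>i<n. emeasure N (F \<inter> cell r e z w i)) = emeasure N (\<Union>i<n. F \<inter> cell r e z w i)"
    by (intro sum_emeasure) auto
  then show ?thesis by simp
qed

text \<open>Replacing \<open>N\<close> by its cell averages preserves the mass of each cell, so mass
  moves by less than \<open>2 * e\<close>: a cell that meets \<open>F\<close> contributes at most
  its whole \<open>N\<close>-mass and lies in the thickening.\<close>

lemma nn_integral_cell_ratio_le:
  assumes [measurable]: "F \<in> sets borel"
  shows "(\<integral>\<^sup>+x. indicator F x * cell_ratio M N r e n z w x \<partial>M)
    \<le> emeasure N ((\<Union>x\<in>F. ball x (2 * e)) \<inter> ball z r)"
proof -
  define U where "U = (\<Union>x\<in>F. ball x (2 * e))"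
  define c where "c i = cell r e z w i" for i
  have "open U" by (auto simp: U_def)
  then have [measurable]: "U \<in> sets borel" "c i \<in> sets borel" for i
    by (auto simp: U_def c_def)
  have "emeasure M (F \<inter> c i) * (emeasure N (c i) / emeasure M (c i)) \<le> emeasure N (U \<inter> c i)" for i
  proof (cases "F \<inter> c i = {}")
    case False
    then have "U \<inter> c i = c i"
      using cell_subset_thickening[of _ F r e z w i] unfolding U_def c_def by blast
    moreover have "emeasure M (F \<inter> c i) / emeasure M (c i) \<le> 1"
      by (intro ennreal_divide_le_one emeasure_mono emeasure_M_finite) auto
    from mult_left_mono[OF this, of "emeasure N (c i)"]
    have "emeasure M (F \<inter> c i) * (emeasure N (c i) / emeasure M (c i)) \<le> emeasure N (c i)"
      by (simp add: ennreal_times_divide mult.commute)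
    ultimately show ?thesis by simp
  qed simp
  then have "(\<integral>\<^sup>+x. indicator F x * cell_ratio M N r e n z w x \<partial>M) \<le> (\<Sum>i<n. emeasure N (U \<inter> c i))"
    unfolding nn_integral_cell_ratio[OF assms] c_def[symmetric] by (rule sum_mono)
  also have "\<dots> = emeasure N (U \<inter> (\<Union>i<n. c i))"
    unfolding c_def by (rule sum_emeasure_N_cells) fact
  also have "U \<inter> (\<Union>i<n. c i) \<subseteq> U \<inter> ball z r"
    using cell_subset_ball[of r e z w] unfolding c_def by blast
  then have "emeasure N (U \<inter> (\<Union>i<n. c i)) \<le> emeasure N (U \<inter> ball z r)"
    by (rule emeasure_mono) measurable
  finally show ?thesis unfolding U_def .
qed

text \<open>The reverse comparison: each cell that meets \<open>F\<close> lies in the thickening and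
  so contributes its whole \<open>N\<close>-mass. The net condition ensures that the cells account
  for all of the \<open>N\<close>-mass of the ball.\<close>

lemma nn_integral_cell_ratio_ge:
  assumes [measurable]: "F \<in> sets borel" and net: "frame_net M r e n z w"
  shows "emeasure N (F \<inter> ball z r)
    \<le> (\<integral>\<^sup>+x. indicator (\<Union>x\<in>F. ball x (2 * e)) x * cell_ratio M N r e n z w x \<partial>M)"
proof -
  define U where "U = (\<Union>x\<in>F. ball x (2 * e))"
  define c where "c i = cell r e z w i" for i
  define R where "R = ball z r - (\<Union>i<n. ball (w i) e)"
  have "open U" by (auto simp: U_def)
  then have [measurable]: "U \<in> sets borel" "c i \<in> sets borel" "R \<in> sets borel" for i
    by (auto simp: U_def c_def R_def)
  have "emeasure N R = 0"
    using net N_le_M[of R] by (simp add: frame_net_def R_def)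
  have "F \<inter> ball z r \<subseteq> (F \<inter> (\<Union>i<n. c i)) \<union> R"
    unfolding c_def UN_cell R_def by blast
  then have "emeasure N (F \<inter> ball z r) \<le> emeasure N ((F \<inter> (\<Union>i<n. c i)) \<union> R)"
    by (intro emeasure_mono) measurable
  also have "\<dots> \<le> emeasure N (F \<inter> (\<Union>i<n. c i)) + emeasure N R"
    by (intro emeasure_subadditive) measurable
  also have "\<dots> = (\<Sum>i<n. emeasure N (F \<inter> c i))"
    using \<open>emeasure N R = 0\<close> sum_emeasure_N_cells[OF assms(1)] by (simp add: c_def)
  also have "\<dots> \<le> (\<Sum>i<n. emeasure M (U \<inter> c i) * (emeasure N (c i) / emeasure M (c i)))"
  proof (rule sum_mono)
    fix i
    show "emeasure N (F \<inter> c i) \<le> emeasure M (U \<inter> c i) * (emeasure N (c i) / emeasure M (c i))"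
    proof (cases "F \<inter> c i = {}")
      case False
      then have U: "U \<inter> c i = c i"
        using cell_subset_thickening[of _ F r e z w i] unfolding U_def c_def by blast
      \<comment> \<open>A cell of \<open>M\<close>-mass 0 has ratio 0, but domination gives it
        \<open>N\<close>-mass 0 as well.\<close>
      have "emeasure N (c i) \<le> emeasure M (c i) * (emeasure N (c i) / emeasure M (c i))"
      proof (cases "emeasure M (c i) = 0")
        case True
        then show ?thesis using N_le_M[of "c i"] by simp
      next
        case False
        then show ?thesis
          using emeasure_M_finite[of "c i"]
          by (simp add: ennreal_times_divide mult.commute[of "emeasure M (c i)"] ennreal_mult_divide_eq)
      qed
      moreover have "emeasure N (F \<inter> c i) \<le> emeasure N (c i)"
        by (intro emeasure_mono) auto
      ultimately show ?thesis unfolding U by simp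
    qed simp
  qed
  also have "\<dots> = (\<integral>\<^sup>+x. indicator U x * cell_ratio M N r e n z w x \<partial>M)"
    by (subst nn_integral_cell_ratio) (auto simp: c_def)
  finally show ?thesis unfolding U_def .
qed

section \<open>Averaging over nets and centres\<close>

sublocale frames: finite_measure "frames M n" for n
proof -
  interpret product_sigma_finite "\<lambda>_::nat. M" by standard
  show "finite_measure (frames M n)"
    by (rule finite_measureI) (simp add: space_PiM emeasure_PiM power_eq_top_ennreal)
qed

lemma net_mass_finite: "net_mass M r e n z < top"
proof -
  have "net_mass M r e n z \<le> (\<integral>\<^sup>+w. 1 \<partial>frames M n)"
    unfolding net_mass_def by (intro nn_integral_mono) (auto simp: indicator_def)
  also have "\<dots> < top"
    by (simp add: less_top[symmetric])
  finally show ?thesis .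
qed

lemma borel_measurable_net_indicator [measurable (raw)]:
  assumes "fz \<in> L \<rightarrow>\<^sub>M (borel :: 'a measure)" "fw \<in> L \<rightarrow>\<^sub>M frames M n"
  shows "(\<lambda>l. indicator (Collect (frame_net M r e n (fz l))) (fw l) :: ennreal) \<in> borel_measurable L"
proof -
  have "(\<lambda>l. fw l i) \<in> L \<rightarrow>\<^sub>M borel" if "i < n" for i
    using measurable_compose[OF assms(2) measurable_component_singleton[of i]] that
    by (simp cong: measurable_cong_sets)
  from measurable_frame_net[OF assms(1) this, where r = r and e = e]
  have [measurable]: "Measurable.pred L (\<lambda>l. frame_net M r e n (fz l) (fw l))" by simp
  show ?thesis unfolding indicator_def mem_Collect_eq of_bool_def by measurable
qed

lemma borel_measurable_cell_ratio_frames [measurable (raw)]: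
  assumes "fz \<in> L \<rightarrow>\<^sub>M (borel :: 'a measure)" "fw \<in> L \<rightarrow>\<^sub>M frames M n"
    "fx \<in> L \<rightarrow>\<^sub>M (borel :: 'a measure)"
  shows "(\<lambda>l. cell_ratio M N r e n (fz l) (fw l) (fx l)) \<in> borel_measurable L"
proof -
  have "(\<lambda>l. fw l i) \<in> L \<rightarrow>\<^sub>M borel" if "i < n" for i
    using measurable_compose[OF assms(2) measurable_component_singleton[of i]] that
    by (simp cong: measurable_cong_sets)
  with assms show ?thesis by (intro borel_measurable_cell_ratio) auto
qed

lemma borel_measurable_net_mass [measurable]: "net_mass M r e n \<in> borel_measurable borel"
  unfolding net_mass_def by measurable

lemma borel_measurable_mean_ratio [measurable (raw)]:
  assumes [measurable]: "fz \<in> L \<rightarrow>\<^sub>M (borel :: 'a measure)" "fx \<in> L \<rightarrow>\<^sub>M (borel :: 'a measure)"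
  shows "(\<lambda>l. mean_ratio M N r e n (fz l) (fx l)) \<in> borel_measurable L"
  unfolding mean_ratio_def by measurable

lemma borel_measurable_profile [measurable]: "profile M N r e n \<in> borel_measurable borel"
  unfolding profile_def by measurable


lemma borel_measurable_emeasure_ball [measurable]: "(\<lambda>x. emeasure M (ball x r)) \<in> borel_measurable borel"
proof (rule measurable_emeasure_section[OF _ M.finite_measure_axioms sets_M])
  have "u \<in> ball l r \<longleftrightarrow> dist l u < r" for l u :: 'a by simp
  then show "Measurable.pred (borel \<Otimes>\<^sub>M M) (\<lambda>(l, u). u \<in> ball l r)"
    by (simp only:) measurable
qed

lemma mean_ratio_le: "mean_ratio M N r e n z x \<le> indicator (ball z r) x"
proof -
  have "(\<integral>\<^sup>+w. indicator (Collect (frame_net M r e n z)) w * cell_ratio M N r e n z w x \<partial>frames M n)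
      \<le> (\<integral>\<^sup>+w. indicator (Collect (frame_net M r e n z)) w * indicator (ball z r) x \<partial>frames M n)"
    by (intro nn_integral_mono mult_left_mono cell_ratio_le) simp
  also have "\<dots> = net_mass M r e n z * indicator (ball z r) x"
    unfolding net_mass_def by (intro nn_integral_multc) measurable
  finally have "mean_ratio M N r e n z x \<le> net_mass M r e n z * indicator (ball z r) x / net_mass M r e n z"
    unfolding mean_ratio_def by (intro divide_right_mono_ennreal)
  also have "\<dots> = net_mass M r e n z / net_mass M r e n z * indicator (ball z r) x"
    by (simp add: divide_ennreal_def ac_simps)
  \<comment> \<open>Only an inequality, since \<open>0 / 0 = 0\<close> when
    \<open>net_mass M r e n z\<close> vanishes.\<close>
  also have "\<dots> \<le> 1 * indicator (ball z r) x"
    by (intro mult_right_mono ennreal_divide_le_one net_mass_finite) auto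
  finally show ?thesis by simp
qed

lemma profile_le: "profile M N r e n x \<le> emeasure M (ball x r)"
proof -
  have "profile M N r e n x \<le> (\<integral>\<^sup>+z. indicator (ball x r) z \<partial>M)"
    unfolding profile_def
    by (intro nn_integral_mono order_trans[OF mean_ratio_le]) (auto simp: indicator_def dist_commute)
  then show ?thesis by simp
qed

text \<open>Two applications of Fubini move the integral over \<open>x\<close> innermost, where
  centre and net are fixed and the comparisons for a single net apply.\<close>

lemma emeasure_density_profile:
  assumes [measurable]: "F \<in> sets borel"
  shows "emeasure (density M (profile M N r e n)) F =
    (\<integral>\<^sup>+z. (\<integral>\<^sup>+w. indicator (Collect (frame_net M r e n z)) w *
       (\<integral>\<^sup>+x. indicator F x * cell_ratio M N r e n z w x \<partial>M) \<partial>frames M n) / net_mass M r e n z \<partial>M)"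
proof -
  interpret MM: pair_sigma_finite M M ..
  interpret FM: pair_sigma_finite "frames M n" M ..
  have "emeasure (density M (profile M N r e n)) F = (\<integral>\<^sup>+x. profile M N r e n x * indicator F x \<partial>M)"
    by (intro emeasure_density) auto
  also have "\<dots> = (\<integral>\<^sup>+x. \<integral>\<^sup>+z. mean_ratio M N r e n z x * indicator F x \<partial>M \<partial>M)"
    unfolding profile_def by (intro nn_integral_cong nn_integral_multc[symmetric]) measurable
  also have "\<dots> = (\<integral>\<^sup>+z. \<integral>\<^sup>+x. mean_ratio M N r e n z x * indicator F x \<partial>M \<partial>M)"
    by (intro MM.Fubini') measurable
  also have "\<dots> = (\<integral>\<^sup>+z. (\<integral>\<^sup>+x. \<integral>\<^sup>+w. indicator (Collect (frame_net M r e n z)) w *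
      (indicator F x * cell_ratio M N r e n z w x) \<partial>frames M n \<partial>M) / net_mass M r e n z \<partial>M)"
  proof (rule nn_integral_cong)
    fix z
    have "mean_ratio M N r e n z x * indicator F x =
        (\<integral>\<^sup>+w. indicator (Collect (frame_net M r e n z)) w *
          (indicator F x * cell_ratio M N r e n z w x) \<partial>frames M n) / net_mass M r e n z" for x
      unfolding mean_ratio_def
      by (cases "x \<in> F") simp_all
    then show "(\<integral>\<^sup>+x. mean_ratio M N r e n z x * indicator F x \<partial>M) =
        (\<integral>\<^sup>+x. \<integral>\<^sup>+w. indicator (Collect (frame_net M r e n z)) w *
          (indicator F x * cell_ratio M N r e n z w x) \<partial>frames M n \<partial>M) / net_mass M r e n z"
      by (simp only:) (intro nn_integral_divide, measurable)
  qed
  also have "\<dots> = (\<integral>\<^sup>+z. (\<integral>\<^sup>+w. \<integral>\<^sup>+x. indicator (Collect (frame_net M r e n z)) w *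
      (indicator F x * cell_ratio M N r e n z w x) \<partial>M \<partial>frames M n) / net_mass M r e n z \<partial>M)"
    by (intro nn_integral_cong arg_cong2[where f = "(/)"] refl FM.Fubini') measurable
  also have "\<dots> = (\<integral>\<^sup>+z. (\<integral>\<^sup>+w. indicator (Collect (frame_net M r e n z)) w *
      (\<integral>\<^sup>+x. indicator F x * cell_ratio M N r e n z w x \<partial>M) \<partial>frames M n) / net_mass M r e n z \<partial>M)"
    by (intro nn_integral_cong arg_cong2[where f = "(/)"] refl nn_integral_cmult) measurable
  finally show ?thesis .
qed

text \<open>This identifies the limit measure. Since \<open>x\<close> lies in
  \<open>ball z r\<close> exactly when \<open>z\<close> lies in \<open>ball x r\<close>, averaging
  over the centres weights \<open>N\<close> by the mass of the ball around each point.\<close>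

lemma nn_integral_emeasure_N_ball:
  assumes [measurable]: "F \<in> sets borel"
  shows "(\<integral>\<^sup>+z. emeasure N (F \<inter> ball z r) \<partial>M) = emeasure (density N (\<lambda>x. emeasure M (ball x r))) F"
proof -
  interpret NM: pair_sigma_finite N M ..
  have [measurable]: "(\<lambda>p. indicator (ball (fst p) r) (snd p) :: ennreal) \<in> borel_measurable (N \<Otimes>\<^sub>M M)"
    "(\<lambda>p. indicator (ball (snd p) r) (fst p) :: ennreal) \<in> borel_measurable (N \<Otimes>\<^sub>M M)"
    unfolding indicator_def of_bool_def mem_ball by measurable
  have "(\<integral>\<^sup>+z. emeasure N (F \<inter> ball z r) \<partial>M) =
      (\<integral>\<^sup>+z. \<integral>\<^sup>+x. indicator F x * indicator (ball z r) x \<partial>N \<partial>M)"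
    by (intro nn_integral_cong) (auto simp flip: indicator_inter_arith)
  also have "\<dots> = (\<integral>\<^sup>+x. \<integral>\<^sup>+z. indicator F x * indicator (ball z r) x \<partial>M \<partial>N)"
    by (intro NM.Fubini') (unfold case_prod_beta', measurable)
  also have "\<dots> = (\<integral>\<^sup>+x. indicator F x * emeasure M (ball x r) \<partial>N)"
  proof (rule nn_integral_cong)
    fix x
    have "(\<integral>\<^sup>+z. indicator F x * indicator (ball z r) x \<partial>M) =
        (\<integral>\<^sup>+z. indicator F x * indicator (ball x r) z \<partial>M)"
      by (intro nn_integral_cong) (simp add: indicator_def dist_commute)
    also have "\<dots> = indicator F x * emeasure M (ball x r)"
      by (simp add: nn_integral_cmult_indicator)
    finally show "(\<integral>\<^sup>+z. indicator F x * indicator (ball z r) x \<partial>M) = indicator F x * emeasure M (ball x r)" .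
  qed
  also have "\<dots> = emeasure (density N (\<lambda>x. emeasure M (ball x r))) F"
    by (subst emeasure_density) (auto simp: mult.commute)
  finally show ?thesis .
qed

text \<open>The bound for a single net does not involve the net, so it survives averaging with total
  weight at most 1, and then integration over \<open>z\<close>.\<close>

lemma emeasure_density_profile_le:
  assumes [measurable]: "F \<in> sets borel"
  shows "emeasure (density M (profile M N r e n)) F
    \<le> emeasure (density N (\<lambda>x. emeasure M (ball x r))) (\<Union>x\<in>F. ball x (2 * e))"
proof -
  define U where "U = (\<Union>x\<in>F. ball x (2 * e))"
  have "open U" by (auto simp: U_def)
  have "emeasure (density M (profile M N r e n)) F \<le> (\<integral>\<^sup>+z. emeasure N (U \<inter> ball z r) \<partial>M)"
    unfolding emeasure_density_profile[OF assms]
  proof (rule nn_integral_mono)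
    fix z
    have "(\<integral>\<^sup>+w. indicator (Collect (frame_net M r e n z)) w *
        (\<integral>\<^sup>+x. indicator F x * cell_ratio M N r e n z w x \<partial>M) \<partial>frames M n) \<le>
        (\<integral>\<^sup>+w. indicator (Collect (frame_net M r e n z)) w * emeasure N (U \<inter> ball z r) \<partial>frames M n)"
      unfolding U_def by (intro nn_integral_mono mult_left_mono nn_integral_cell_ratio_le assms) simp
    also have "\<dots> = net_mass M r e n z * emeasure N (U \<inter> ball z r)"
      unfolding net_mass_def by (intro nn_integral_multc) measurable
    finally have "(\<integral>\<^sup>+w. indicator (Collect (frame_net M r e n z)) w *
        (\<integral>\<^sup>+x. indicator F x * cell_ratio M N r e n z w x \<partial>M) \<partial>frames M n) / net_mass M r e n z \<le>
        net_mass M r e n z * emeasure N (U \<inter> ball z r) / net_mass M r e n z"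
      by (intro divide_right_mono_ennreal)
    also have "\<dots> = net_mass M r e n z / net_mass M r e n z * emeasure N (U \<inter> ball z r)"
      by (simp add: divide_ennreal_def ac_simps)
    also have "\<dots> \<le> 1 * emeasure N (U \<inter> ball z r)"
      by (intro mult_right_mono ennreal_divide_le_one net_mass_finite) auto
    finally show "(\<integral>\<^sup>+w. indicator (Collect (frame_net M r e n z)) w *
        (\<integral>\<^sup>+x. indicator F x * cell_ratio M N r e n z w x \<partial>M) \<partial>frames M n) / net_mass M r e n z \<le>
        emeasure N (U \<inter> ball z r)" by simp
  qed
  also have "\<dots> = emeasure (density N (\<lambda>x. emeasure M (ball x r))) U"
    using \<open>open U\<close> by (intro nn_integral_emeasure_N_ball) simp
  finally show ?thesis unfolding U_def .
qed

text \<open>For a lower bound the weights must add up to exactly 1, whence the positivity of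
  \<open>net_mass\<close>.\<close>

lemma emeasure_density_profile_ge:
  assumes [measurable]: "F \<in> sets borel" and pos: "\<And>z. 0 < net_mass M r e n z"
  shows "emeasure (density N (\<lambda>x. emeasure M (ball x r))) F
    \<le> emeasure (density M (profile M N r e n)) (\<Union>x\<in>F. ball x (2 * e))"
proof -
  define U where "U = (\<Union>x\<in>F. ball x (2 * e))"
  have "open U" by (auto simp: U_def)
  then have [measurable]: "U \<in> sets borel" by simp
  have "emeasure (density N (\<lambda>x. emeasure M (ball x r))) F = (\<integral>\<^sup>+z. emeasure N (F \<inter> ball z r) \<partial>M)"
    by (rule nn_integral_emeasure_N_ball[symmetric]) fact
  also have "\<dots> \<le> emeasure (density M (profile M N r e n)) U"
    unfolding emeasure_density_profile[OF \<open>U \<in> sets borel\<close>]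
  proof (rule nn_integral_mono)
    fix z
    have "emeasure N (F \<inter> ball z r) = net_mass M r e n z * emeasure N (F \<inter> ball z r) / net_mass M r e n z"
      using pos[of z] net_mass_finite[of r e n z]
      by (simp add: mult.commute[of "net_mass M r e n z"] ennreal_mult_divide_eq)
    also have "net_mass M r e n z * emeasure N (F \<inter> ball z r) =
        (\<integral>\<^sup>+w. indicator (Collect (frame_net M r e n z)) w * emeasure N (F \<inter> ball z r) \<partial>frames M n)"
      unfolding net_mass_def by (intro nn_integral_multc[symmetric]) measurable
    also have "\<dots> \<le> (\<integral>\<^sup>+w. indicator (Collect (frame_net M r e n z)) w *
        (\<integral>\<^sup>+x. indicator U x * cell_ratio M N r e n z w x \<partial>M) \<partial>frames M n)"
      unfolding U_def
      by (intro nn_integral_mono) (auto simp: indicator_def[of "Collect _"] intro!: nn_integral_cell_ratio_ge assms)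
    finally show "emeasure N (F \<inter> ball z r) \<le> (\<integral>\<^sup>+w. indicator (Collect (frame_net M r e n z)) w *
        (\<integral>\<^sup>+x. indicator U x * cell_ratio M N r e n z w x \<partial>M) \<partial>frames M n) / net_mass M r e n z"
      by (simp add: divide_right_mono_ennreal)
  qed
  finally show ?thesis unfolding U_def .
qed

text \<open>Pick one point of \<open>ball z r\<close> in each ball of the cover that meets it. All
  tuples obtained by small perturbations inside \<open>ball z r\<close> are still nets, and they
  form a box of positive product measure. The length \<open>card C\<close> of the tuples is the same
  for all \<open>z\<close>, which isometry invariance requires.\<close>

lemma net_mass_pos:
  fixes C :: "'a set"
  assumes pos: "\<And>x s. 0 < s \<Longrightarrow> 0 < emeasure M (ball x s)"
    and "0 < r" "0 < e" and C: "finite C" "UNIV \<subseteq> (\<Union>c\<in>C. ball c (e / 4))"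
  shows "0 < net_mass M r e (card C) z"
proof -
  interpret product_sigma_finite "\<lambda>_::nat. M" by standard
  obtain h where h: "bij_betw h {..<card C} C"
    using ex_bij_betw_nat_finite[OF C(1)] by (auto simp: atLeast0LessThan)
  \<comment> \<open>Where the small ball misses \<open>ball z r\<close>, the centre \<open>z\<close>
    fills the slot, so that the tuple has all its entries in the ball.\<close>
  have "\<exists>v. v \<in> ball z r \<and> (ball z r \<inter> ball (h i) (e / 4) \<noteq> {} \<longrightarrow> v \<in> ball (h i) (e / 4))" for i
    using centre_in_ball[of z r] \<open>0 < r\<close> by blast
  then obtain v where v: "\<And>i. v i \<in> ball z r"
    "\<And>i. ball z r \<inter> ball (h i) (e / 4) \<noteq> {} \<Longrightarrow> v i \<in> ball (h i) (e / 4)"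
    by metis
  \<comment> \<open>The radii add up: \<open>e / 2\<close> from \<open>w i\<close> to
    \<open>v i\<close>, then \<open>e / 4\<close> to \<open>h i\<close> and \<open>e / 4\<close> to
    the covered point.\<close>
  define A where "A i = ball (v i) (e / 2) \<inter> ball z r" for i
  have A_sets: "A i \<in> sets M" for i by (simp add: A_def)
  have A_pos: "0 < emeasure M (A i)" for i
  proof -
    have "open (A i)" "v i \<in> A i"
      using v(1)[of i] \<open>0 < e\<close> by (auto simp: A_def)
    then obtain s where "0 < s" "ball (v i) s \<subseteq> A i"
      using open_contains_ball by blast
    with pos[of s "v i"] emeasure_mono[OF this(2) A_sets] show ?thesis by simp
  qed
  have net: "frame_net M r e (card C) z w" if w: "w \<in> Pi\<^sub>E {..<card C} A" for w
  proof -
    have "u \<in> (\<Union>i<card C. ball (w i) e)" if u: "u \<in> ball z r" for u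
    proof -
      obtain c where c: "c \<in> C" "u \<in> ball c (e / 4)" using C(2) by blast
      then obtain i where i: "i < card C" "h i = c"
        using bij_betw_imp_surj_on[OF h] by (metis imageE lessThan_iff)
      have "v i \<in> ball (h i) (e / 4)" using v(2)[of i] u c i(2) by blast
      then have "dist (h i) (v i) < e / 4" "dist (h i) u < e / 4"
        using c(2) i(2) by auto
      moreover have "dist (v i) (w i) < e / 2"
        using w i(1) by (auto simp: A_def PiE_iff)
      ultimately have "dist (w i) u < e"
        using dist_triangle[of "w i" u "v i"] dist_triangle3[of "v i" u "h i"] by (simp add: dist_commute)
      with i(1) show ?thesis by auto
    qed
    then have "ball z r - (\<Union>i<card C. ball (w i) e) = {}" by blast
    moreover have "w i \<in> ball z r" if "i < card C" for i
      using w that by (auto simp: A_def PiE_iff)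
    ultimately show ?thesis
      unfolding frame_net_def by (metis emeasure_empty)
  qed
  have "0 < (\<Prod>i<k. emeasure M (A i))" for k
  proof (induction k)
    case (Suc k)
    then show ?case using A_pos[of k] by (simp add: ennreal_zero_less_mult_iff)
  qed simp
  then have "0 < (\<Prod>i<card C. emeasure M (A i))" .
  also have "\<dots> = emeasure (frames M (card C)) (Pi\<^sub>E {..<card C} A)"
    by (intro emeasure_PiM[symmetric] A_sets) simp
  also have "\<dots> = (\<integral>\<^sup>+w. indicator (Pi\<^sub>E {..<card C} A) w \<partial>frames M (card C))"
    by (intro nn_integral_indicator[symmetric] sets_PiM_I_finite A_sets) simp
  also have "\<dots> \<le> net_mass M r e (card C) z"
    unfolding net_mass_def using net by (intro nn_integral_mono) (auto simp: indicator_def)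
  finally show ?thesis .
qed

end

section \<open>Invariance under isometries of balls\<close>

text \<open>The map is total and Borel so that \<open>distr\<close> applies, but only its behaviour
  on \<open>ball a s\<close> counts. The push-forward identities take the place of surjectivity onto
  \<open>ball b s\<close>.\<close>

locale ball_isometry = separable_measure_pair M N D
  for M N :: "'a::metric_space measure" and D :: "'a set" +
  fixes \<phi> :: "'a \<Rightarrow> 'a" and a b :: 'a and s :: real
  assumes borel_measurable [measurable]: "\<phi> \<in> borel \<rightarrow>\<^sub>M borel"
    and centre: "\<phi> a = b"
    and dist_eq: "\<And>u v. u \<in> ball a s \<Longrightarrow> v \<in> ball a s \<Longrightarrow> dist (\<phi> u) (\<phi> v) = dist u v"
    and distr_M: "distr (density M (indicator (ball a s))) borel \<phi> = density M (indicator (ball b s))"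
    and distr_N: "distr (density N (indicator (ball a s))) borel \<phi> = density N (indicator (ball b s))"
begin

lemma dist_centre: "u \<in> ball a s \<Longrightarrow> dist b (\<phi> u) = dist a u"
  using dist_eq[of a u] centre by (auto simp: dist_pos_lt intro: le_less_trans[OF zero_le_dist])

lemma nn_integral_transport:
  assumes [measurable]: "g \<in> borel_measurable borel"
  shows "(\<integral>\<^sup>+y. indicator (ball b s) y * g y \<partial>M) = (\<integral>\<^sup>+y. indicator (ball a s) y * g (\<phi> y) \<partial>M)"
proof -
  have restrict: "(\<integral>\<^sup>+y. f y \<partial>density M (indicator (ball c s))) = (\<integral>\<^sup>+y. indicator (ball c s) y * f y \<partial>M)"
    if "f \<in> borel_measurable borel" for c and f :: "'a \<Rightarrow> ennreal"
    using that by (intro nn_integral_density borel_measurable_indicator) (simp_all cong: measurable_cong_sets)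
  have "(\<integral>\<^sup>+y. g y \<partial>density M (indicator (ball b s))) = (\<integral>\<^sup>+y. g (\<phi> y) \<partial>density M (indicator (ball a s)))"
    unfolding distr_M[symmetric] by (intro nn_integral_distr) measurable
  then show ?thesis by (simp add: restrict)
qed

text \<open>Correspondence of membership on \<open>ball a s\<close> suffices, so images under
  \<open>\<phi>\<close> never have to be computed or shown measurable.\<close>

lemma emeasure_transport:
  assumes K: "K = M \<or> K = N" and [measurable]: "B \<in> sets borel" "A \<in> sets borel"
    and "B \<subseteq> ball b s" "A \<subseteq> ball a s" and iff: "\<And>u. u \<in> ball a s \<Longrightarrow> \<phi> u \<in> B \<longleftrightarrow> u \<in> A"
  shows "emeasure K B = emeasure K A"
proof -
  have [simp, measurable_cong]: "sets K = sets borel" and [simp]: "space K = UNIV" using K by auto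
  have pre: "\<phi> -` B \<in> sets borel"
    using measurable_sets[OF borel_measurable, of B] by simp
  have "emeasure K B = emeasure K (ball b s \<inter> B)"
    using \<open>B \<subseteq> ball b s\<close> by (simp add: Int_absorb1)
  also have "\<dots> = emeasure (density K (indicator (ball b s))) B"
    by (intro emeasure_restricted[symmetric]) simp_all
  also have "\<dots> = emeasure (distr (density K (indicator (ball a s))) borel \<phi>) B"
    using K distr_M distr_N by auto
  also have "\<dots> = emeasure (density K (indicator (ball a s))) (\<phi> -` B)"
    by (subst emeasure_distr) auto
  also have "\<dots> = emeasure K (ball a s \<inter> \<phi> -` B)"
    using pre by (intro emeasure_restricted) simp_all
  also have "ball a s \<inter> \<phi> -` B = A"
    using iff \<open>A \<subseteq> ball a s\<close> by blast
  finally show ?thesis .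
qed

lemma emeasure_ball_transport: "r \<le> s \<Longrightarrow> emeasure M (ball b r) = emeasure M (ball a r)"
  using dist_centre by (intro emeasure_transport) auto

text \<open>Restricting a product to a cube is the same as restricting each factor. With
  \<open>distr_frames\<close> this lets whole tuples be transported coordinate by coordinate; both
  identities are checked on boxes.\<close>

lemma frames_density:
  assumes [measurable]: "B \<in> sets borel"
  shows "density (frames M n) (indicator (Pi\<^sub>E {..<n} (\<lambda>_. B))) = PiM {..<n} (\<lambda>_. density M (indicator B))"
proof -
  interpret pM: product_sigma_finite "\<lambda>_::nat. M" by standard
  interpret finite_measure "density M (indicator B)"
    by (rule M.finite_measure_restricted) simp
  interpret pB: product_sigma_finite "\<lambda>_::nat. density M (indicator B)" by standard
  have cube [measurable]: "Pi\<^sub>E {..<n} (\<lambda>_. B) \<in> sets (frames M n)"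
    by (intro sets_PiM_I_finite) auto
  show ?thesis
  proof (rule pB.PiM_eqI)
    show "sets (density (frames M n) (indicator (Pi\<^sub>E {..<n} (\<lambda>_. B)))) =
        sets (Pi\<^sub>M {..<n} (\<lambda>_. density M (indicator B)))"
      by (auto intro!: sets_PiM_cong)
    fix A assume A: "\<And>i. i \<in> {..<n} \<Longrightarrow> A i \<in> sets (density M (indicator B))"
    then have [measurable]: "A i \<in> sets borel" if "i < n" for i using that by simp
    have "emeasure (density (frames M n) (indicator (Pi\<^sub>E {..<n} (\<lambda>_. B)))) (Pi\<^sub>E {..<n} A) =
        emeasure (frames M n) (Pi\<^sub>E {..<n} (\<lambda>i. B \<inter> A i))"
      using A by (subst emeasure_restricted) (auto simp: PiE_Int intro!: sets_PiM_I_finite)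
    also have "\<dots> = (\<Prod>i<n. emeasure M (B \<inter> A i))"
      using A by (intro pM.emeasure_PiM) auto
    also have "\<dots> = (\<Prod>i<n. emeasure (density M (indicator B)) (A i))"
      by (intro prod.cong refl emeasure_restricted[symmetric]) auto
    finally show "emeasure (density (frames M n) (indicator (Pi\<^sub>E {..<n} (\<lambda>_. B)))) (Pi\<^sub>E {..<n} A) =
        (\<Prod>i<n. emeasure (density M (indicator B)) (A i))" .
  qed simp
qed

text \<open>The restriction keeps the image tuple extensional, as \<open>PiM\<close>
  demands.\<close>

abbreviation map_frame :: "nat \<Rightarrow> (nat \<Rightarrow> 'a) \<Rightarrow> nat \<Rightarrow> 'a" where
  "map_frame n w \<equiv> \<lambda>i\<in>{..<n}. \<phi> (w i)"

lemma distr_frames: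
  "distr (PiM {..<n} (\<lambda>_. density M (indicator (ball a s)))) (frames M n) (map_frame n) =
    PiM {..<n} (\<lambda>_. density M (indicator (ball b s)))"
proof -
  have fin: "finite_measure (density M (indicator (ball c s)))" for c
    by (rule M.finite_measure_restricted) simp
  interpret A: finite_measure "density M (indicator (ball a s))" by (rule fin)
  interpret B: finite_measure "density M (indicator (ball b s))" by (rule fin)
  interpret pA: product_sigma_finite "\<lambda>_::nat. density M (indicator (ball a s))" by standard
  interpret pB: product_sigma_finite "\<lambda>_::nat. density M (indicator (ball b s))" by standard
  have meas: "map_frame n \<in> PiM {..<n} (\<lambda>_. density M (indicator (ball a s))) \<rightarrow>\<^sub>M frames M n"
    by measurable
  show ?thesis
  proof (rule pB.PiM_eqI)
    show "sets (distr (PiM {..<n} (\<lambda>_. density M (indicator (ball a s)))) (frames M n) (map_frame n)) =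
        sets (Pi\<^sub>M {..<n} (\<lambda>_. density M (indicator (ball b s))))"
      by (auto intro!: sets_PiM_cong)
    fix A assume A: "\<And>i. i \<in> {..<n} \<Longrightarrow> A i \<in> sets (density M (indicator (ball b s)))"
    then have [measurable]: "A i \<in> sets borel" if "i < n" for i using that by simp
    have pre: "\<phi> -` A i \<in> sets borel" if "i < n" for i
      using measurable_sets[OF borel_measurable, of "A i"] that by simp
    have "emeasure (distr (PiM {..<n} (\<lambda>_. density M (indicator (ball a s)))) (frames M n) (map_frame n))
        (Pi\<^sub>E {..<n} A) = emeasure (PiM {..<n} (\<lambda>_. density M (indicator (ball a s))))
          (Pi\<^sub>E {..<n} (\<lambda>i. \<phi> -` A i))"
      using A meas by (subst emeasure_distr)
        (auto simp: space_PiM intro!: sets_PiM_I_finite arg_cong[where f = "emeasure _"])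
    also have "\<dots> = (\<Prod>i<n. emeasure (density M (indicator (ball a s))) (\<phi> -` A i))"
      using pre by (intro pA.emeasure_PiM) auto
    also have "\<dots> = (\<Prod>i<n. emeasure (density M (indicator (ball b s))) (A i))"
      unfolding distr_M[symmetric] by (intro prod.cong refl) (subst emeasure_distr, auto)
    finally show "emeasure (distr (PiM {..<n} (\<lambda>_. density M (indicator (ball a s)))) (frames M n) (map_frame n))
        (Pi\<^sub>E {..<n} A) = (\<Prod>i<n. emeasure (density M (indicator (ball b s))) (A i))" .
  qed simp
qed

lemma nn_integral_frames_transport:
  assumes [measurable]: "g \<in> borel_measurable (frames M n)"
  shows "(\<integral>\<^sup>+w. indicator (Pi\<^sub>E {..<n} (\<lambda>_. ball b s)) w * g w \<partial>frames M n) =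
    (\<integral>\<^sup>+w. indicator (Pi\<^sub>E {..<n} (\<lambda>_. ball a s)) w * g (map_frame n w) \<partial>frames M n)"
proof -
  have [measurable]: "Pi\<^sub>E {..<n} (\<lambda>_. ball c s) \<in> sets (frames M n)" for c
    by (intro sets_PiM_I_finite) auto
  have [measurable]: "map_frame n \<in> frames M n \<rightarrow>\<^sub>M frames M n"
    by measurable
  have "(\<integral>\<^sup>+w. indicator (Pi\<^sub>E {..<n} (\<lambda>_. ball b s)) w * g w \<partial>frames M n) =
      (\<integral>\<^sup>+w. g w \<partial>PiM {..<n} (\<lambda>_. density M (indicator (ball b s))))"
    by (subst frames_density[symmetric]) (auto simp: nn_integral_density)
  also have "\<dots> = (\<integral>\<^sup>+w. g (map_frame n w) \<partial>PiM {..<n} (\<lambda>_. density M (indicator (ball a s))))"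
    unfolding distr_frames[symmetric] by (subst nn_integral_distr) measurable
  also have "\<dots> = (\<integral>\<^sup>+w. indicator (Pi\<^sub>E {..<n} (\<lambda>_. ball a s)) w * g (map_frame n w) \<partial>frames M n)"
    by (subst frames_density[symmetric]) (auto simp: nn_integral_density)
  finally show ?thesis .
qed

lemma mem_ball_transport:
  "z \<in> ball a s \<Longrightarrow> u \<in> ball a s \<Longrightarrow> \<phi> u \<in> ball (\<phi> z) q \<longleftrightarrow> u \<in> ball z q"
  by (simp only: mem_ball dist_eq)

lemma cell_transport:
  assumes "z \<in> ball a s" "\<And>i. i < n \<Longrightarrow> w i \<in> ball a s" "i < n" "u \<in> ball a s"
  shows "\<phi> u \<in> cell r e (\<phi> z) (map_frame n w) i \<longleftrightarrow> u \<in> cell r e z w i"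
  using assms unfolding cell_def by (simp add: mem_ball_transport del: mem_ball)

context
  fixes r :: real and z :: 'a
  assumes z: "z \<in> ball a r" and r: "2 * r \<le> s"
begin

text \<open>The triangle inequality and \<open>2 * r \<le> s\<close> keep \<open>ball z r\<close>,
  and with it every net and cell for \<open>z\<close>, inside the ball where \<open>\<phi>\<close>
  is an isometry. On the other side \<open>\<phi> z\<close> is as far from \<open>b\<close> as
  \<open>z\<close> is from \<open>a\<close>.\<close>

lemma inner_ball_subset: "ball z r \<subseteq> ball a s" and inner_ball_subset': "ball (\<phi> z) r \<subseteq> ball b s"
  and z_mem: "z \<in> ball a s"
proof -
  have "0 < r" using z by (auto intro: le_less_trans[OF zero_le_dist])
  with z r show zs: "z \<in> ball a s" by auto
  show "ball z r \<subseteq> ball a s"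
  proof
    fix u assume "u \<in> ball z r"
    with z r dist_triangle[of a u z] show "u \<in> ball a s" by simp
  qed
  show "ball (\<phi> z) r \<subseteq> ball b s"
  proof
    fix u assume "u \<in> ball (\<phi> z) r"
    with z r dist_triangle[of b u "\<phi> z"] dist_centre[OF zs] show "u \<in> ball b s" by simp
  qed
qed

lemma emeasure_cell_transport:
  assumes "K = M \<or> K = N" "\<And>i. i < n \<Longrightarrow> w i \<in> ball a s" "i < n"
  shows "emeasure K (cell r e (\<phi> z) (map_frame n w) i) = emeasure K (cell r e z w i)"
  using assms cell_subset_ball inner_ball_subset inner_ball_subset' z_mem
  by (intro emeasure_transport cell_transport sets_cell) blast+

lemma frame_net_transport:
  assumes w: "\<And>i. i < n \<Longrightarrow> w i \<in> ball a s"
  shows "frame_net M r e n (\<phi> z) (map_frame n w) \<longleftrightarrow> frame_net M r e n z w"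
proof -
  have "map_frame n w i \<in> ball (\<phi> z) r \<longleftrightarrow> w i \<in> ball z r" if "i < n" for i
    using that mem_ball_transport[OF z_mem w] by simp
  moreover have "emeasure M (ball (\<phi> z) r - (\<Union>i<n. ball (map_frame n w i) e)) =
      emeasure M (ball z r - (\<Union>i<n. ball (w i) e))"
  proof (rule emeasure_transport)
    fix u assume "u \<in> ball a s"
    then show "\<phi> u \<in> ball (\<phi> z) r - (\<Union>i<n. ball (map_frame n w i) e) \<longleftrightarrow>
        u \<in> ball z r - (\<Union>i<n. ball (w i) e)"
      using w z_mem by (simp add: mem_ball_transport del: mem_ball)
  qed (use inner_ball_subset inner_ball_subset' in auto)
  ultimately show ?thesis unfolding frame_net_def by auto
qed

lemma cell_ratio_transport:
  assumes w: "\<And>i. i < n \<Longrightarrow> w i \<in> ball a s"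
  shows "cell_ratio M N r e n (\<phi> z) (map_frame n w) b = cell_ratio M N r e n z w a"
proof -
  have "a \<in> ball a s"
    using z_mem by (auto intro: le_less_trans[OF zero_le_dist])
  then have "b \<in> cell r e (\<phi> z) (map_frame n w) i \<longleftrightarrow> a \<in> cell r e z w i" if "i < n" for i
    using cell_transport[OF z_mem w that, where u = a and r = r and e = e] centre by simp
  then show ?thesis
    unfolding cell_ratio_def using emeasure_cell_transport[OF _ w]
    by (intro sum.cong) (auto simp: indicator_def)
qed

text \<open>The points of a net for \<open>\<phi> z\<close> lie in \<open>ball b s\<close>, so
  inserting the indicator of that cube changes nothing and the change of variables applies. Tuples
  leaving \<open>ball a s\<close> are not nets for \<open>z\<close>, so both integrands vanish
  there.\<close>

lemma nn_integral_net_transport: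
  assumes [measurable]: "g \<in> borel_measurable (frames M n)"
    and eq: "\<And>w. (\<And>i. i < n \<Longrightarrow> w i \<in> ball a s) \<Longrightarrow> g (map_frame n w) = h w"
  shows "(\<integral>\<^sup>+w. indicator (Collect (frame_net M r e n (\<phi> z))) w * g w \<partial>frames M n) =
    (\<integral>\<^sup>+w. indicator (Collect (frame_net M r e n z)) w * h w \<partial>frames M n)"
proof -
  have "(\<integral>\<^sup>+w. indicator (Collect (frame_net M r e n (\<phi> z))) w * g w \<partial>frames M n) =
      (\<integral>\<^sup>+w. indicator (Pi\<^sub>E {..<n} (\<lambda>_. ball b s)) w *
        (indicator (Collect (frame_net M r e n (\<phi> z))) w * g w) \<partial>frames M n)"
    using inner_ball_subset'
    by (intro nn_integral_cong)
      (auto simp: indicator_def frame_net_def space_PiM PiE_iff subset_iff simp del: mem_ball)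
  also have "\<dots> = (\<integral>\<^sup>+w. indicator (Pi\<^sub>E {..<n} (\<lambda>_. ball a s)) w *
      (indicator (Collect (frame_net M r e n (\<phi> z))) (map_frame n w) * g (map_frame n w)) \<partial>frames M n)"
    by (rule nn_integral_frames_transport) measurable
  also have "\<dots> = (\<integral>\<^sup>+w. indicator (Collect (frame_net M r e n z)) w * h w \<partial>frames M n)"
  proof (rule nn_integral_cong)
    fix w assume w: "w \<in> space (frames M n)"
    show "indicator (Pi\<^sub>E {..<n} (\<lambda>_. ball a s)) w *
        (indicator (Collect (frame_net M r e n (\<phi> z))) (map_frame n w) * g (map_frame n w)) =
        indicator (Collect (frame_net M r e n z)) w * h w"
    proof (cases "\<forall>i<n. w i \<in> ball a s")
      case True
      with w frame_net_transport[of n w e] eq[of w] show ?thesis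
        by (simp add: indicator_def space_PiM PiE_iff)
    next
      case False
      then have "\<not> frame_net M r e n z w" "w \<notin> Pi\<^sub>E {..<n} (\<lambda>_. ball a s)"
        using inner_ball_subset by (auto simp: frame_net_def PiE_iff simp del: mem_ball)
      then show ?thesis by simp
    qed
  qed
  finally show ?thesis .
qed

lemma mean_ratio_transport: "mean_ratio M N r e n (\<phi> z) b = mean_ratio M N r e n z a"
proof -
  have "net_mass M r e n (\<phi> z) = net_mass M r e n z"
    using nn_integral_net_transport[of "\<lambda>_. 1" n "\<lambda>_. 1" e] by (simp add: net_mass_def)
  moreover have "(\<integral>\<^sup>+w. indicator (Collect (frame_net M r e n (\<phi> z))) w *
      cell_ratio M N r e n (\<phi> z) w b \<partial>frames M n) =
    (\<integral>\<^sup>+w. indicator (Collect (frame_net M r e n z)) w * cell_ratio M N r e n z w a \<partial>frames M n)"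
    by (intro nn_integral_net_transport cell_ratio_transport) measurable
  ultimately show ?thesis unfolding mean_ratio_def by simp
qed

end

text \<open>Only centres within \<open>r\<close> of the point contribute, so the integral may be cut
  down to the balls of radius \<open>s\<close> and transported. For \<open>z\<close> outside
  \<open>ball a r\<close> both mean ratios vanish, because \<open>\<phi>\<close> preserves the
  distance to the centre.\<close>

lemma profile_transport:
  assumes r: "2 * r \<le> s"
  shows "profile M N r e n b = profile M N r e n a"
proof -
  have zero: "mean_ratio M N r e n z x = 0" if "x \<notin> ball z r" for z x
    using mean_ratio_le[of r e n z x] that by simp
  have sub: "ball c r \<subseteq> ball c s" for c :: 'a
  proof (cases "0 < r")
    case True
    with r show ?thesis by (intro subset_ball) simp
  qed (simp add: ball_empty)
  have ind: "mean_ratio M N r e n z c = indicator (ball c s) z * mean_ratio M N r e n z c" for z c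
  proof (cases "z \<in> ball c s")
    case False
    then have "c \<notin> ball z r" using sub[of c] by (auto simp: dist_commute subset_iff)
    then show ?thesis by (simp add: zero)
  qed simp
  have "profile M N r e n b = (\<integral>\<^sup>+z. indicator (ball b s) z * mean_ratio M N r e n z b \<partial>M)"
    unfolding profile_def by (intro nn_integral_cong ind)
  also have "\<dots> = (\<integral>\<^sup>+z. indicator (ball a s) z * mean_ratio M N r e n (\<phi> z) b \<partial>M)"
    by (rule nn_integral_transport) measurable
  also have "\<dots> = (\<integral>\<^sup>+z. indicator (ball a s) z * mean_ratio M N r e n z a \<partial>M)"
  proof (intro nn_integral_cong)
    fix z
    have "mean_ratio M N r e n (\<phi> z) b = mean_ratio M N r e n z a" if z: "z \<in> ball a s"
    proof (cases "z \<in> ball a r")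
      case True
      then show ?thesis using r by (rule mean_ratio_transport)
    next
      case False
      then have "a \<notin> ball z r" "b \<notin> ball (\<phi> z) r"
        using dist_centre[OF z] by (auto simp: dist_commute)
      then show ?thesis by (simp add: zero)
    qed
    then show "indicator (ball a s) z * mean_ratio M N r e n (\<phi> z) b =
        indicator (ball a s) z * mean_ratio M N r e n z a"
      by (cases "z \<in> ball a s") simp_all
  qed
  also have "\<dots> = profile M N r e n a"
    unfolding profile_def by (intro nn_integral_cong ind[symmetric])
  finally show ?thesis .
qed

end

section \<open>Proportionality\<close>

text \<open>Compatibility speaks of open sets only, but these are stable under intersection and
  generate the Borel sets, so finite measures agreeing on them coincide. The value \<open>c\<close>
  off the ball just makes the map total.\<close>

lemma isometry_onto_ball_transport:
  fixes f :: "'a::metric_space \<Rightarrow> 'a" and c :: 'a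
  assumes f: "isometry_onto f (ball a s) (ball b s)"
  defines "\<phi> \<equiv> \<lambda>u. if u \<in> ball a s then f u else c"
  shows "\<phi> \<in> borel \<rightarrow>\<^sub>M borel"
    and "\<And>K. isometrically_compatible K \<Longrightarrow> finite_measure K \<Longrightarrow>
      distr (density K (indicator (ball a s))) borel \<phi> = density K (indicator (ball b s))"
proof -
  have dist: "dist (f u) (f v) = dist u v" if "u \<in> ball a s" "v \<in> ball a s" for u v
    using f that unfolding isometry_onto_def by blast
  have image: "f ` ball a s = ball b s"
    using f unfolding isometry_onto_def by blast
  have cont: "continuous_on (ball a s) f"
    unfolding continuous_on_iff by (auto simp: dist simp del: mem_ball)
  show [measurable]: "\<phi> \<in> borel \<rightarrow>\<^sub>M borel"
    unfolding \<phi>_def using cont by (intro borel_measurable_continuous_on_if continuous_on_const) simp_all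
  fix K :: "'a measure"
  assume K: "isometrically_compatible K" and "finite_measure K"
  interpret finite_measure K by fact
  have sets_K [simp, measurable_cong]: "sets K = sets borel"
    using K by (simp add: isometrically_compatible_def)
  interpret b: finite_measure "density K (indicator (ball b s))"
    by (rule finite_measure_restricted) simp
  show "distr (density K (indicator (ball a s))) borel \<phi> = density K (indicator (ball b s))"
  proof (rule measure_eqI_generator_eq[symmetric, where E = "Collect open" and \<Omega> = UNIV and A = "\<lambda>_. UNIV"])
    fix V :: "'a set" assume "V \<in> Collect open"
    then have V: "open V" by simp
    \<comment> \<open>This preimage is open by continuity of \<open>f\<close>, and \<open>f\<close>
      restricts to an isometry of it onto the open set \<open>ball b s \<inter> V\<close>.\<close>
    define U where "U = ball a s \<inter> f -` V"
    have "open U"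
      unfolding U_def by (rule continuous_open_preimage[OF cont open_ball V])
    have "f ` U = ball b s \<inter> V"
      unfolding U_def image[symmetric] by auto
    then have "isometry_onto f U (ball b s \<inter> V)"
      unfolding isometry_onto_def by (auto simp: U_def dist simp del: mem_ball)
    then have "emeasure K U = emeasure K (ball b s \<inter> V)"
      using K \<open>open U\<close> V unfolding isometrically_compatible_def by blast
    also have "U = ball a s \<inter> \<phi> -` V"
      unfolding U_def \<phi>_def by auto
    finally have "emeasure K (ball a s \<inter> \<phi> -` V) = emeasure K (ball b s \<inter> V)" .
    moreover have "\<phi> -` V \<in> sets borel"
      using measurable_sets[of \<phi> borel borel V] V by simp
    ultimately show "emeasure (density K (indicator (ball b s))) V =
        emeasure (distr (density K (indicator (ball a s))) borel \<phi>) V"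
      using V sets_eq_imp_space_eq[OF sets_K] by (simp add: emeasure_distr emeasure_restricted)
  next
    show "sets (density K (indicator (ball b s))) = sigma_sets UNIV (Collect open)"
      "sets (distr (density K (indicator (ball a s))) borel \<phi>) = sigma_sets UNIV (Collect open)"
      by (simp_all add: sets_borel)
  qed (auto simp: Int_stable_def)
qed

section \<open>Proportionality from local isometries to a base point\<close>

context separable_measure_pair
begin

lemma finite_measure_density_bounded:
  assumes "finite_measure K" and [simp]: "sets K = sets borel"
    and f: "f \<in> borel_measurable borel" "\<And>x. f x \<le> emeasure M UNIV"
  shows "finite_measure (density K f)"
proof (rule finite_measureI)
  interpret K: finite_measure K by fact
  have "f \<in> borel_measurable K"
    using f(1) measurable_cong_sets[OF \<open>sets K = sets borel\<close> refl] by blast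
  then have "emeasure (density K f) (space K) = (\<integral>\<^sup>+x. f x * indicator (space K) x \<partial>K)"
    by (rule emeasure_density) (rule sets.top)
  also have "\<dots> \<le> (\<integral>\<^sup>+x. emeasure M UNIV \<partial>K)"
    using f(2) by (intro nn_integral_mono) (simp add: indicator_def)
  also have "\<dots> < top"
  proof -
    have "emeasure K (space K) < top" by (simp add: less_top[symmetric])
    then show ?thesis
      unfolding nn_integral_const ennreal_mult_less_top using emeasure_M_finite[of UNIV] by blast
  qed
  finally show "emeasure (density K f) (space (density K f)) \<noteq> \<infinity>" by simp
qed

text \<open>The cross-multiplied form passes to limits without division by masses that might
  vanish.\<close>

lemma measures_proportional:
  assumes tb: "totally_bounded (UNIV :: 'a set)"
    and pos: "\<And>x s. 0 < s \<Longrightarrow> 0 < emeasure M (ball x s)"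
    and homogeneous: "\<And>b. \<exists>s>0. \<exists>\<phi>. ball_isometry M N D \<phi> a b s"
    and A: "A \<in> sets borel"
  shows "measure N A * measure M UNIV = measure N UNIV * measure M A"
proof -
  define d where "d j = 1 / real (Suc j)" for j
  have d: "decseq d" "d \<longlonglongrightarrow> 0" "0 < d j" for j
  proof -
    show "decseq d" by (auto simp: decseq_def d_def intro!: divide_left_mono)
    show "d \<longlonglongrightarrow> 0"
      unfolding d_def using LIMSEQ_inverse_real_of_nat by (simp only: inverse_eq_divide)
  qed (simp add: d_def)
  \<comment> \<open>The mesh is \<open>e = d j / 2\<close>, which makes the thickening radius
    \<open>2 * e\<close> equal to \<open>d j\<close>; \<open>net_mass_pos\<close> asks for a cover
    of radius \<open>e / 4\<close>.\<close>
  have "\<exists>C :: 'a set. finite C \<and> UNIV \<subseteq> (\<Union>c\<in>C. ball c (d j / 2 / 4))" for j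
  proof -
    have "0 < d j / 2 / 4" using d(3)[of j] by simp
    with tb show ?thesis unfolding totally_bounded_metric ball_def by blast
  qed
  then obtain C :: "nat \<Rightarrow> 'a set" where C: "\<And>j. finite (C j)"
    "\<And>j. UNIV \<subseteq> (\<Union>c\<in>C j. ball c (d j / 2 / 4))"
    by metis
  define p where "p r j = profile M N r (d j / 2) (card (C j))" for r j
  have p_meas [measurable]: "p r j \<in> borel_measurable borel" for r j
    unfolding p_def by measurable
  have p_le: "p r j x \<le> emeasure M UNIV" for r j x
    unfolding p_def by (intro order_trans[OF profile_le] emeasure_mono) auto
  define L where "L r j = density M (p r j)" for r j
  define R where "R r = density N (\<lambda>x. emeasure M (ball x r))" for r
  have L_eq: "emeasure (L r j) B = (\<integral>\<^sup>+x. p r j x * indicator B x \<partial>M)" if "B \<in> sets borel" for r j B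
    unfolding L_def using that by (intro emeasure_density) simp_all
  have R_eq: "emeasure (R r) B = (\<integral>\<^sup>+x. emeasure M (ball x r) * indicator B x \<partial>N)" if "B \<in> sets borel" for r B
    unfolding R_def using that by (intro emeasure_density) simp_all
  have fin_L: "finite_measure (L r j)" for r j
    unfolding L_def using p_le by (intro finite_measure_density_bounded M.finite_measure_axioms) auto
  have fin_R: "finite_measure (R r)" for r
    unfolding R_def
    by (intro finite_measure_density_bounded N.finite_measure_axioms emeasure_mono) auto
  \<comment> \<open>The densities \<open>p r j\<close> are bounded by the total mass of
    \<open>M\<close>, which serves as the constant in the domination; the two thickening bounds come
    from \<open>emeasure_density_profile_le\<close> and
    \<open>emeasure_density_profile_ge\<close>.\<close>
  have conv: "(\<lambda>j. measure (L r j) B) \<longlonglongrightarrow> measure (R r) B" if "0 < r" "B \<in> sets borel" for r B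
  proof (rule borel_measure_tendsto_of_thickenings[OF fin_L _ fin_R _ M.finite_measure_axioms sets_M _ _ _ d \<open>B \<in> sets borel\<close>])
    show "sets (L r j) = sets borel" "sets (R r) = sets borel" for j
      by (simp_all add: L_def R_def)
    fix j
    interpret L: finite_measure "L r j" by (rule fin_L)
    interpret R: finite_measure "R r" by (rule fin_R)
    show "measure (L r j) B \<le> measure M UNIV * measure M B" if "B \<in> sets borel" for B
    proof -
      have "emeasure (L r j) B \<le> (\<integral>\<^sup>+x. emeasure M UNIV * indicator B x \<partial>M)"
        unfolding L_eq[OF that] by (intro nn_integral_mono mult_right_mono p_le) simp
      also have "\<dots> = emeasure M UNIV * emeasure M B"
        using that by (intro nn_integral_cmult_indicator) simp
      finally show ?thesis
        by (simp add: L.emeasure_eq_measure M.emeasure_eq_measure flip: ennreal_mult)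
    qed
    fix F :: "'a set" assume "closed F"
    then have F: "F \<in> sets borel" by simp
    have "0 < net_mass M r (d j / 2) (card (C j)) z" for z
      using pos \<open>0 < r\<close> d(3)[of j] C by (intro net_mass_pos) auto
    from emeasure_density_profile_ge[OF F this]
    show "measure (R r) F \<le> measure (L r j) (\<Union>x\<in>F. ball x (d j))"
      by (simp add: L.emeasure_eq_measure R.emeasure_eq_measure flip: L_def R_def p_def)
    from emeasure_density_profile_le[OF F, of r "d j / 2" "card (C j)"]
    show "measure (L r j) F \<le> measure (R r) (\<Union>x\<in>F. ball x (d j))"
      by (simp add: L.emeasure_eq_measure R.emeasure_eq_measure flip: L_def R_def p_def)
  qed
  text \<open>
    The points whose \<open>2 * r\<close>-ball is isometric to that of \<open>a\<close> need not form a Borel set;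
    \<open>E r\<close> is a Borel set containing them.
  \<close>
  define E where "E r = {x. (\<forall>j. p r j x = p r j a) \<and> emeasure M (ball x r) = emeasure M (ball a r)}" for r
  have E_sets [measurable]: "E r \<in> sets borel" for r
    unfolding E_def by measurable
  \<comment> \<open>On \<open>E r\<close> the density \<open>p r j\<close> is constant, so
    \<open>L r j\<close> is there a multiple of \<open>M\<close>, with a factor depending on
    \<open>j\<close>. The factor is common to \<open>A\<close> and \<open>B\<close>, so
    cross-multiplying removes it before the limit is taken. In the limit \<open>R r\<close> is
    \<open>h\<close> times \<open>N\<close> on \<open>E r\<close>, and \<open>h\<close> is
    positive.\<close>
  have E_proportional: "measure N A * measure M B = measure N B * measure M A"
    if "0 < r" "A \<in> sets borel" "B \<in> sets borel" "A \<subseteq> E r" "B \<subseteq> E r" for r A B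
  proof -
    define h where "h = measure M (ball a r)"
    have L_E: "measure (L r j) B = enn2real (p r j a) * measure M B" if "B \<in> sets borel" "B \<subseteq> E r" for j B
    proof -
      have "emeasure (L r j) B = (\<integral>\<^sup>+x. p r j a * indicator B x \<partial>M)"
        unfolding L_eq[OF that(1)] using that(2)
        by (intro nn_integral_cong) (auto simp: E_def indicator_def)
      also have "\<dots> = p r j a * emeasure M B"
        using that(1) by (intro nn_integral_cmult_indicator) simp
      finally show ?thesis by (simp add: measure_def enn2real_mult)
    qed
    have R_E: "measure (R r) B = h * measure N B" if "B \<in> sets borel" "B \<subseteq> E r" for B
    proof -
      have "emeasure (R r) B = (\<integral>\<^sup>+x. emeasure M (ball a r) * indicator B x \<partial>N)"
        unfolding R_eq[OF that(1)] using that(2)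
        by (intro nn_integral_cong) (auto simp: E_def indicator_def)
      also have "\<dots> = emeasure M (ball a r) * emeasure N B"
        using that(1) by (intro nn_integral_cmult_indicator) simp
      finally show ?thesis by (simp add: measure_def enn2real_mult h_def)
    qed
    have "(\<lambda>j. measure (L r j) A * measure M B) \<longlonglongrightarrow> h * measure N A * measure M B"
      using conv[OF that(1,2)] R_E[OF that(2,4)] by (auto intro!: tendsto_mult_right)
    moreover have "(\<lambda>j. measure (L r j) B * measure M A) \<longlonglongrightarrow> h * measure N B * measure M A"
      using conv[OF that(1,3)] R_E[OF that(3,5)] by (auto intro!: tendsto_mult_right)
    moreover have "(\<lambda>j. measure (L r j) A * measure M B) = (\<lambda>j. measure (L r j) B * measure M A)"
      unfolding L_E[OF that(2,4)] L_E[OF that(3,5)] by (simp only: mult.assoc mult.commute mult.left_commute)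
    ultimately have "h * measure N A * measure M B = h * measure N B * measure M A"
      using LIMSEQ_unique by metis
    moreover have "0 < h"
      using pos[OF \<open>0 < r\<close>, of a] by (simp add: h_def M.emeasure_eq_measure)
    ultimately show ?thesis by simp
  qed
  \<comment> \<open>The sets \<open>E (d m)\<close> are not known to grow with \<open>m\<close>;
    intersecting over tails gives an increasing sequence.\<close>
  define S where "S k = (\<Inter>m\<in>{k..}. E (d m))" for k
  have S_sets [measurable]: "S k \<in> sets borel" for k
    unfolding S_def by measurable
  have "incseq S"
    unfolding incseq_def S_def by force
  have "(\<Union>k. S k) = UNIV"
  proof (rule UNIV_eq_I[symmetric])
    fix b
    obtain s \<phi> where "0 < s" and "ball_isometry M N D \<phi> a b s" using homogeneous by blast
    interpret ball_isometry M N D \<phi> a b s by fact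
    \<comment> \<open>From this index on, \<open>2 * d m \<le> s\<close>, so invariance of the
      profile applies and puts \<open>b\<close> into every later \<open>E (d m)\<close>.\<close>
    have "\<forall>\<^sub>F k in sequentially. d k < s / 2"
      using \<open>0 < s\<close> by (intro order_tendstoD(2)[OF d(2)]) simp
    then obtain k where k: "d k < s / 2"
      using eventually_happens'[OF sequentially_bot] by blast
    have "b \<in> E (d m)" if "k \<le> m" for m
    proof -
      have "d m \<le> d k" using d(1) that by (simp add: decseq_def)
      with k have "2 * d m \<le> s" by simp
      moreover from this d(3)[of m] have "d m \<le> s" by simp
      ultimately show ?thesis
        unfolding E_def p_def using profile_transport emeasure_ball_transport by blast
    qed
    then have "b \<in> S k" unfolding S_def by blast
    then show "b \<in> (\<Union>k. S k)" by blast
  qed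
  have lim: "(\<lambda>k. measure K (B \<inter> S k)) \<longlonglongrightarrow> measure K B"
    if "B \<in> sets borel" "finite_measure K" "sets K = sets borel" for B K
  proof -
    interpret K: finite_measure K by fact
    have "(\<lambda>k. measure K (B \<inter> S k)) \<longlonglongrightarrow> measure K (\<Union>k. B \<inter> S k)"
      using that(1,3) \<open>incseq S\<close>
      by (intro K.finite_Lim_measure_incseq) (auto simp: incseq_def)
    then show ?thesis
      using \<open>(\<Union>k. S k) = UNIV\<close> by (simp flip: Int_UN_distrib)
  qed
  note lims = lim[OF _ M.finite_measure_axioms sets_M] lim[OF _ N.finite_measure_axioms sets_N]
  have "(\<lambda>k. measure N (A \<inter> S k) * measure M (UNIV \<inter> S k)) \<longlonglongrightarrow> measure N A * measure M UNIV"
    using A by (intro tendsto_mult lims) auto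
  moreover have "(\<lambda>k. measure N (UNIV \<inter> S k) * measure M (A \<inter> S k)) \<longlonglongrightarrow> measure N UNIV * measure M A"
    using A by (intro tendsto_mult lims) auto
  moreover have "measure N (A \<inter> S k) * measure M (UNIV \<inter> S k) = measure N (UNIV \<inter> S k) * measure M (A \<inter> S k)" for k
    using d(3)[of k] A by (intro E_proportional[of "d k"]) (auto simp: S_def)
  ultimately show ?thesis
    using LIMSEQ_unique by simp
qed

end

section \<open>Sums of measures, positivity of balls and the theorem\<close>

definition sum_measure :: "'a measure \<Rightarrow> 'a measure \<Rightarrow> 'a measure" where
  "sum_measure M N = measure_of (space M) (sets M) (\<lambda>A. emeasure M A + emeasure N A)"

lemma sets_sum_measure [simp]: "sets (sum_measure M N) = sets M"
  and space_sum_measure [simp]: "space (sum_measure M N) = space M"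
  by (simp_all add: sum_measure_def)

lemma emeasure_sum_measure:
  assumes "sets M = sets N" "A \<in> sets M"
  shows "emeasure (sum_measure M N) A = emeasure M A + emeasure N A"
proof (rule emeasure_measure_of[OF sum_measure_def])
  show "countably_additive (sets (sum_measure M N)) (\<lambda>A. emeasure M A + emeasure N A)"
    using assms(1) by (auto simp: countably_additive_def suminf_add[symmetric] suminf_emeasure)
qed (use assms sets.space_closed in \<open>auto simp: positive_def\<close>)

lemma isometrically_compatible_sum_measure:
  fixes M N :: "'a::metric_space measure"
  shows "isometrically_compatible M \<Longrightarrow> isometrically_compatible N \<Longrightarrow>
    isometrically_compatible (sum_measure M N)"
  unfolding isometrically_compatible_def by (auto simp: emeasure_sum_measure)

lemma totally_bounded_imp_countable_dense:
  assumes "totally_bounded (UNIV :: 'a::metric_space set)"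
  obtains D :: "'a::metric_space set" where "countable D" "\<And>x e. 0 < e \<Longrightarrow> \<exists>d\<in>D. dist x d < e"
proof -
  have "\<exists>C :: 'a set. finite C \<and> (\<forall>x. \<exists>c\<in>C. dist c x < 1 / real (Suc k))" for k
    using assms unfolding totally_bounded_metric by (auto simp: subset_eq)
  then obtain C :: "nat \<Rightarrow> 'a set" where C: "\<And>k. finite (C k)"
    "\<And>k x. \<exists>c\<in>C k. dist c x < 1 / real (Suc k)"
    by metis
  show thesis
  proof (rule that[of "\<Union>k. C k"])
    show "countable (\<Union>k. C k)"
      using C(1) by (simp add: countable_finite)
    fix x :: 'a and e :: real assume "0 < e"
    then obtain k where "1 / real (Suc k) < e"
      using nat_approx_posE by blast
    moreover obtain c where "c \<in> C k" "dist c x < 1 / real (Suc k)"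
      using C(2) by blast
    ultimately show "\<exists>d\<in>(\<Union>k. C k). dist x d < e"
      by (auto simp: dist_commute intro!: bexI[of _ c])
  qed
qed

text \<open>
  By homogeneity, a null ball yields a null ball around every point; countably many of
  these cover the space.
\<close>

lemma homogeneous_emeasure_ball_pos:
  fixes M :: "'a::metric_space measure"
  assumes tb: "totally_bounded (UNIV :: 'a set)" and hom: "homogeneous_space TYPE('a)"
    and M: "isometrically_compatible M" and nonzero: "emeasure M UNIV \<noteq> 0" and "0 < r"
  shows "0 < emeasure M (ball x r)"
proof (rule ccontr)
  assume "\<not> 0 < emeasure M (ball x r)"
  then have null: "emeasure M (ball x r) = 0" by (simp add: zero_less_iff_neq_zero)
  have sets_M [simp]: "sets M = sets borel"
    using M by (simp add: isometrically_compatible_def)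
  obtain D :: "'a set" where D: "countable D" "\<And>y e. 0 < e \<Longrightarrow> \<exists>d\<in>D. dist y d < e"
    by (rule totally_bounded_imp_countable_dense[OF tb]) blast
  have null_ball: "\<exists>t>0. emeasure M (ball y t) = 0" for y
  proof -
    from hom have "(x, y) \<in> homogeneity_rel" by (simp add: homogeneous_space_iff)
    then obtain s f where "0 < s" and f: "isometry_onto f (ball x s) (ball y s)" "f x = y"
      by (auto simp: homogeneity_rel_def)
    \<comment> \<open>Small enough both for the isometry to restrict to balls of radius
      \<open>t\<close> and for \<open>ball x t\<close> to lie in the null ball.\<close>
    define t where "t = min s r"
    have "0 < t" "t \<le> s" "t \<le> r" using \<open>0 < s\<close> \<open>0 < r\<close> by (auto simp: t_def)
    from isometry_onto_subball[OF f this(1,2)] M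
    have "emeasure M (ball x t) = emeasure M (ball y t)"
      unfolding isometrically_compatible_def by blast
    moreover have "emeasure M (ball x t) \<le> emeasure M (ball x r)"
      using \<open>t \<le> r\<close> by (intro emeasure_mono subset_ball) auto
    ultimately show ?thesis using null \<open>0 < t\<close> by auto
  qed
  define I where "I = {(d, q). d \<in> D \<and> q \<in> \<rat> \<and> emeasure M (ball d q) = 0}"
  have "countable I"
    by (rule countable_subset[of _ "D \<times> \<rat>"]) (use D(1) countable_rat in \<open>auto simp: I_def\<close>)
  have "(\<Union>(d, q)\<in>I. ball d q) = UNIV"
  proof (rule UNIV_eq_I[symmetric])
    fix y
    obtain t where t: "0 < t" "emeasure M (ball y t) = 0" using null_ball by blast
    \<comment> \<open>With a rational \<open>q\<close> strictly between \<open>dist y d\<close> and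
      \<open>t / 2\<close>, the ball \<open>ball d q\<close> contains \<open>y\<close> and lies
      inside the null ball \<open>ball y t\<close>.\<close>
    obtain d where d: "d \<in> D" "dist y d < t / 2" using D(2)[of "t / 2"] t(1) by auto
    obtain q where q: "q \<in> \<rat>" "dist y d < q" "q < t / 2"
      using Rats_dense_in_real[OF d(2)] by blast
    have "ball d q \<subseteq> ball y t"
    proof
      fix u assume "u \<in> ball d q"
      with q d(2) dist_triangle[of y u d] show "u \<in> ball y t" by simp
    qed
    with t(2) have "emeasure M (ball d q) = 0"
      by (metis borel_open emeasure_eq_0 open_ball sets_M)
    with d(1) q(1,2) show "y \<in> (\<Union>(d, q)\<in>I. ball d q)"
      by (auto simp: I_def dist_commute)
  qed
  moreover have "emeasure M (\<Union>p\<in>I. ball (fst p) (snd p)) = 0"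
    by (rule null_setsD1, rule null_sets_UN'[OF \<open>countable I\<close>]) (auto simp: I_def null_sets_def)
  ultimately show False using nonzero by (simp add: case_prod_beta')
qed

theorem theorem8:
  fixes P P' :: "'a::metric_space measure"
  assumes "totally_bounded (UNIV :: 'a set)"
    and "homogeneous_space TYPE('a)"
    and "isometrically_compatible P" and "finite_measure P" and "P \<noteq> null_measure borel"
    and "isometrically_compatible P'" and "finite_measure P'"
  shows "(\<exists>l::real. \<forall>A\<in>sets borel. measure P' A = l * measure P A) \<and>
         (prob_space P \<and> prob_space P' \<longrightarrow> P = P')"
proof -
  interpret P: finite_measure P by fact
  interpret P': finite_measure P' by fact
  have sets_P [simp]: "sets P = sets borel" and sets_P' [simp]: "sets P' = sets borel"
    using assms(3,6) by (simp_all add: isometrically_compatible_def)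
  have space_P [simp]: "space P = UNIV" and space_P' [simp]: "space P' = UNIV"
    using sets_eq_imp_space_eq[OF sets_P] sets_eq_imp_space_eq[OF sets_P'] by simp_all
  have P_nonzero: "emeasure P UNIV \<noteq> 0"
  proof
    assume 0: "emeasure P UNIV = 0"
    have "P = null_measure borel"
    proof (rule measure_eqI)
      fix A assume "A \<in> sets P"
      have "emeasure P A \<le> emeasure P UNIV" by (intro emeasure_mono) auto
      with 0 show "emeasure P A = emeasure (null_measure borel) A" by simp
    qed simp
    with assms(5) show False by contradiction
  qed
  define M where "M = sum_measure P P'"
  have M_eq: "emeasure M A = emeasure P A + emeasure P' A" if "A \<in> sets borel" for A
    unfolding M_def using that by (intro emeasure_sum_measure) auto
  have sets_M: "sets M = sets borel" by (simp add: M_def)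
  have compat_M: "isometrically_compatible M"
    unfolding M_def using assms(3,6) by (rule isometrically_compatible_sum_measure)
  have fin_M: "finite_measure M"
    by (rule finite_measureI) (simp add: M_eq M_def[THEN arg_cong[where f = space]])
  interpret M: finite_measure M by (rule fin_M)
  have M_measure: "measure M A = measure P A + measure P' A" if "A \<in> sets borel" for A
    using M_eq[OF that] by (simp add: M.emeasure_eq_measure P.emeasure_eq_measure P'.emeasure_eq_measure
        flip: ennreal_plus)
  obtain D :: "'a set" where D: "countable D" "\<And>y e. 0 < e \<Longrightarrow> \<exists>d\<in>D. dist y d < e"
    by (rule totally_bounded_imp_countable_dense[OF assms(1)]) blast
  interpret pair: separable_measure_pair M P' D
    using D sets_M M_eq by unfold_locales auto
  have pos: "0 < emeasure M (ball x s)" if "0 < s" for x s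
    using that P_nonzero
    by (intro homogeneous_emeasure_ball_pos[OF assms(1,2) compat_M]) (auto simp: M_eq)
  \<comment> \<open>Any base point will do.\<close>
  define a :: 'a where "a = undefined"
  have hom: "\<exists>s>0. \<exists>\<phi>. ball_isometry M P' D \<phi> a b s" for b
  proof -
    from assms(2) have "(a, b) \<in> homogeneity_rel" by (simp add: homogeneous_space_iff)
    then obtain s f where "0 < s" and f: "isometry_onto f (ball a s) (ball b s)" "f a = b"
      by (auto simp: homogeneity_rel_def)
    note transport = isometry_onto_ball_transport[OF f(1), where c = b]
    have "ball_isometry M P' D (\<lambda>u. if u \<in> ball a s then f u else b) a b s"
    proof
      show "dist (if u \<in> ball a s then f u else b) (if v \<in> ball a s then f v else b) = dist u v"
        if "u \<in> ball a s" "v \<in> ball a s" for u v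
        using f(1) that unfolding isometry_onto_def by simp
      show "(if a \<in> ball a s then f a else b) = b"
        using f(2) \<open>0 < s\<close> by simp
    qed (rule transport transport(2)[OF compat_M fin_M] transport(2)[OF assms(6,7)])+
    with \<open>0 < s\<close> show ?thesis by blast
  qed
  have P_pos: "0 < measure P UNIV"
    using P_nonzero by (simp add: P.emeasure_eq_measure zero_less_measure_iff)
  have eq: "measure P' A = measure P' UNIV / measure P UNIV * measure P A" if "A \<in> sets borel" for A
  proof -
    \<comment> \<open>The product \<open>measure P' A * measure P' UNIV\<close> occurs on both sides
      and cancels, which leaves a relation between \<open>P\<close> and \<open>P'\<close>
      alone.\<close>
    have "measure P' A * (measure P UNIV + measure P' UNIV) = measure P' UNIV * (measure P A + measure P' A)"
      using pair.measures_proportional[OF assms(1) pos hom that] by (simp add: M_measure that)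
    with P_pos show ?thesis by (simp add: field_simps)
  qed
  have "P = P'" if "prob_space P" "prob_space P'"
  proof (rule measure_eqI)
    fix A assume "A \<in> sets P"
    moreover have "measure P UNIV = 1" "measure P' UNIV = 1"
      using prob_space.prob_space[OF that(1)] prob_space.prob_space[OF that(2)] by simp_all
    ultimately show "emeasure P A = emeasure P' A"
      using eq[of A] by (simp add: P.emeasure_eq_measure P'.emeasure_eq_measure)
  qed simp
  with eq show ?thesis by blast
qed

end
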